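(* Let $u_h:[0,\infty)\to X_h$ be the solution of the semidiscrete problem $$(u_h'',v)+\beta\,a_h(u_h',v)+\alpha(u_h',v)+a_h(u_h,v)=0\quad\forall v\in X_h,\qquad u_h(0)=u_{0h},\ u_h'(0)=u_{1h},$$ with $u_{0h},u_{1h}\in X_h$, and let $E_h(u_h)(t)=\frac12\left(\|u_h'(t)\|^2+|u_h(t)|_1^2\right)$. Let $0<\delta\le\min\left(\frac{\alpha+\beta\lambda_1}{2},\frac{\lambda_1}{\alpha+\beta\lambda_1}\right)$. Then the following hold for all $t\ge0$. (i) If $0<\delta<\min\left(\frac{\alpha+\beta\lambda_1}{2},\frac{\lambda_1}{\alpha+\beta\lambda_1}\right)$ or $0<\delta=\frac{\alpha+\beta\lambda_1}{2}$, then there is a constant $C=C(\alpha,\beta,\lambda_1)>0$, independent of $h$, $t$ and the initial data, such that $$E_h(u_h)(t)\le C\,e^{-2\delta t}E_h(u_h)(0).$$ (ii) If $0<\delta=\frac{\lambda_1}{\alpha+\beta\lambda_1}$, then there is a constant $C>0$, independent of $h$, $t$ and the initial data, such that $$\|u_h'(t)\|^2\le C\,e^{-2\delta t}E_h(u_h)(0).$$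
   Context: $\Omega\subset\mathbb{R}^d$ is a bounded domain; $\|\cdot\|$, $(\cdot,\cdot)$ are the $L^2(\Omega)$ norm and inner product; $A=-\Delta$ with domain $H^2(\Omega)\cap H_0^1(\Omega)$, $\lambda_1>0$ its smallest eigenvalue, so $\|v\|^2\le\lambda_1^{-1}\|A^{1/2}v\|^2$ for $v\in H_0^1(\Omega)$; $|v|_1=\|A^{1/2}v\|=\|\nabla v\|$. The damping parameters are constants with ($\alpha>0$, $\beta\ge0$) or ($\alpha\ge0$, $\beta>0$). $X_h\subset H_0^1(\Omega)$ is a finite-dimensional (finite element) subspace associated with a shape regular triangulation of $\bar\Omega$ of mesh size $h$, satisfying $\inf_{\psi_h\in X_h}\{\|\psi-\psi_h\|+h\|\psi-\psi_h\|_1\}\le Ch^2\|\psi\|_2$ for all $\psi\in H^2(\Omega)\cap H_0^1(\Omega)$. The bilinear form is $a_h(w_h,\chi_h)=(A^{1/2}w_h,A^{1/2}\chi_h)=(A_hw_h,\chi_h)$ for $w_h,\chi_h\in X_h$, which defines $A_h:X_h\to X_h$; so $\|A_h^{1/2}\chi_h\|=|\chi_h|_1$. Primes denote time derivatives. *)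

theory Defs
  imports "HOL-Analysis.Analysis"
begin

section \<open>The Hilbert space of square-integrable functions\<close>

definition square_integrable :: "('a::euclidean_space \<Rightarrow> real) \<Rightarrow> bool" where
  "square_integrable f \<longleftrightarrow> f \<in> borel_measurable borel \<and> integrable lborel (\<lambda>x. (f x)\<^sup>2)"

lemma square_integrable_mult:
  assumes "square_integrable f" "square_integrable g"
  shows "integrable lborel (\<lambda>x. f x * g x)"
proof (rule Bochner_Integration.integrable_bound)
  show "integrable lborel (\<lambda>x. (f x)\<^sup>2 + (g x)\<^sup>2)"
    using assms by (simp add: square_integrable_def)
  show "(\<lambda>x. f x * g x) \<in> borel_measurable lborel"
    using assms by (auto simp: square_integrable_def)
  have "\<bar>a * b\<bar> \<le> a\<^sup>2 + b\<^sup>2" for a b :: real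
  proof -
    have "2 * (\<bar>a\<bar> * \<bar>b\<bar>) \<le> a\<^sup>2 + b\<^sup>2"
      using sum_squares_bound[of "\<bar>a\<bar>" "\<bar>b\<bar>"] by simp
    moreover have "0 \<le> \<bar>a\<bar> * \<bar>b\<bar>" by simp
    ultimately show ?thesis unfolding abs_mult by linarith
  qed
  then show "AE x in lborel. norm (f x * g x) \<le> norm ((f x)\<^sup>2 + (g x)\<^sup>2)"
    by simp
qed

lemma square_integrable_zero: "square_integrable (\<lambda>x. 0)"
  by (simp add: square_integrable_def)

lemma square_integrable_add:
  assumes "square_integrable f" "square_integrable g"
  shows "square_integrable (\<lambda>x. f x + g x)"
proof -
  have "integrable lborel (\<lambda>x. (f x)\<^sup>2 + (g x)\<^sup>2 + 2 * (f x * g x))"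
    using assms square_integrable_mult[OF assms] by (simp add: square_integrable_def)
  then show ?thesis
    using assms by (auto simp: square_integrable_def power2_sum mult.assoc)
qed

lemma square_integrable_scale:
  assumes "square_integrable f"
  shows "square_integrable (\<lambda>x. c * f x)"
  using assms by (auto simp: square_integrable_def power_mult_distrib)

lemma square_integrable_minus:
  assumes "square_integrable f"
  shows "square_integrable (\<lambda>x. - f x)"
  using assms by (simp add: square_integrable_def)

lemma square_integrable_diff:
  assumes "square_integrable f" "square_integrable g"
  shows "square_integrable (\<lambda>x. f x - g x)"
  using square_integrable_add[OF assms(1) square_integrable_minus[OF assms(2)]] by simp

text \<open>A type cannot depend on the domain, so \<open>'a l2\<close> is the space over the whole of \<open>'a\<close>;
  the space over a domain is the subspace \<open>L2\<close> below of elements vanishing almost everywhere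
  outside of it.\<close>

quotient_type (overloaded) 'a l2 = "'a::euclidean_space \<Rightarrow> real" / partial:
  "\<lambda>f g. square_integrable f \<and> square_integrable g \<and> (AE x in lborel. f x = g x)"
proof (rule part_equivpI)
  show "\<exists>f::'a \<Rightarrow> real. square_integrable f \<and> square_integrable f \<and> (AE x in lborel. f x = f x)"
    using square_integrable_zero by auto
  show "symp (\<lambda>f g::'a \<Rightarrow> real.
      square_integrable f \<and> square_integrable g \<and> (AE x in lborel. f x = g x))"
    by (auto simp: symp_def)
  show "transp (\<lambda>f g::'a \<Rightarrow> real.
      square_integrable f \<and> square_integrable g \<and> (AE x in lborel. f x = g x))"
    by (auto simp: transp_def)
qed

instantiation l2 :: (euclidean_space) real_inner
begin

lift_definition zero_l2 :: "'a l2" is "\<lambda>x. 0"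
  by (simp add: square_integrable_zero)

lift_definition plus_l2 :: "'a l2 \<Rightarrow> 'a l2 \<Rightarrow> 'a l2" is "\<lambda>f g x. f x + g x"
  by (auto intro: square_integrable_add)

lift_definition minus_l2 :: "'a l2 \<Rightarrow> 'a l2 \<Rightarrow> 'a l2" is "\<lambda>f g x. f x - g x"
  by (auto intro: square_integrable_diff)

lift_definition uminus_l2 :: "'a l2 \<Rightarrow> 'a l2" is "\<lambda>f x. - f x"
  by (auto intro: square_integrable_minus)

lift_definition scaleR_l2 :: "real \<Rightarrow> 'a l2 \<Rightarrow> 'a l2" is "\<lambda>c f x. c * f x"
  by (auto intro: square_integrable_scale)

lift_definition inner_l2 :: "'a l2 \<Rightarrow> 'a l2 \<Rightarrow> real" is
  "\<lambda>f g. integral\<^sup>L lborel (\<lambda>x. f x * g x)"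
  by (rule integral_cong_AE) (auto simp: square_integrable_def)

definition norm_l2 :: "'a l2 \<Rightarrow> real" where
  "norm_l2 f = sqrt (f \<bullet> f)"

definition dist_l2 :: "'a l2 \<Rightarrow> 'a l2 \<Rightarrow> real" where
  "dist_l2 f g = norm (f - g)"

definition sgn_l2 :: "'a l2 \<Rightarrow> 'a l2" where
  "sgn_l2 f = inverse (norm f) *\<^sub>R f"

definition uniformity_l2 :: "('a l2 \<times> 'a l2) filter" where
  "uniformity_l2 = (INF e\<in>{0 <..}. principal {(f, g). dist f g < e})"

definition open_l2 :: "'a l2 set \<Rightarrow> bool" where
  "open_l2 U \<longleftrightarrow> (\<forall>f\<in>U. eventually (\<lambda>(f', g). f' = f \<longrightarrow> g \<in> U) uniformity)"

instance
proof
  fix f g k :: "'a l2" and c d :: real and U :: "'a l2 set"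
  show "f + g + k = f + (g + k)"
    by transfer (auto simp: add.assoc intro: square_integrable_add)
  show "f + g = g + f"
    by transfer (auto simp: add.commute intro: square_integrable_add)
  show "0 + f = f"
    by transfer (auto intro: square_integrable_add)
  show "- f + f = 0"
    by transfer (auto simp: square_integrable_zero)
  show "f - g = f + - g"
    by transfer (auto intro: square_integrable_add square_integrable_diff square_integrable_minus)
  show "c *\<^sub>R (f + g) = c *\<^sub>R f + c *\<^sub>R g"
    by transfer (auto simp: distrib_left intro: square_integrable_add square_integrable_scale)
  show "(c + d) *\<^sub>R f = c *\<^sub>R f + d *\<^sub>R f"
    by transfer (auto simp: distrib_right intro: square_integrable_add square_integrable_scale)
  show "c *\<^sub>R d *\<^sub>R f = (c * d) *\<^sub>R f"
    by transfer (auto simp: mult.assoc intro: square_integrable_scale)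
  show "1 *\<^sub>R f = f"
    by transfer (auto intro: square_integrable_scale)
  show "dist f g = norm (f - g)"
    by (fact dist_l2_def)
  show "sgn f = inverse (norm f) *\<^sub>R f"
    by (fact sgn_l2_def)
  show "(uniformity :: ('a l2 \<times> 'a l2) filter) = (INF e\<in>{0 <..}. principal {(f, g). dist f g < e})"
    by (fact uniformity_l2_def)
  show "open U \<longleftrightarrow> (\<forall>f\<in>U. eventually (\<lambda>(f', g). f' = f \<longrightarrow> g \<in> U) uniformity)"
    by (fact open_l2_def)
  show "f \<bullet> g = g \<bullet> f"
    by transfer (simp add: mult.commute)
  show "(f + g) \<bullet> k = f \<bullet> k + g \<bullet> k"
    by transfer (simp add: distrib_right square_integrable_mult)
  show "(c *\<^sub>R f) \<bullet> g = c * (f \<bullet> g)"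
    by transfer (simp add: mult.assoc)
  show "0 \<le> f \<bullet> f"
    by transfer simp
  show "f \<bullet> f = 0 \<longleftrightarrow> f = 0"
  proof transfer
    fix f :: "'a \<Rightarrow> real"
    assume f: "square_integrable f \<and> square_integrable f \<and> (AE x in lborel. f x = f x)"
    then have "integral\<^sup>L lborel (\<lambda>x. f x * f x) = 0 \<longleftrightarrow> (AE x in lborel. f x * f x = 0)"
      by (intro integral_nonneg_eq_0_iff_AE square_integrable_mult) auto
    with f show "integral\<^sup>L lborel (\<lambda>x. f x * f x) = 0 \<longleftrightarrow>
        square_integrable f \<and> square_integrable (\<lambda>x::'a. 0::real) \<and> (AE x in lborel. f x = 0)"
      by (simp add: square_integrable_zero)
  qed
  show "norm f = sqrt (f \<bullet> f)"
    by (fact norm_l2_def)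
qed

end

lift_definition vanishes_outside :: "'a::euclidean_space set \<Rightarrow> 'a l2 \<Rightarrow> bool" is
  "\<lambda>\<Omega> f. AE x in lborel. x \<notin> \<Omega> \<longrightarrow> f x = 0"
  by (auto elim: AE_mp)

definition L2 :: "'a::euclidean_space set \<Rightarrow> 'a l2 set" where
  "L2 \<Omega> = {f. vanishes_outside \<Omega> f}"


section \<open>Test functions and Sobolev spaces\<close>

definition partial_deriv :: "'a::euclidean_space \<Rightarrow> ('a \<Rightarrow> real) \<Rightarrow> 'a \<Rightarrow> real" where
  "partial_deriv b f x = frechet_derivative f (at x) b"

primrec C_diff :: "nat \<Rightarrow> ('a::euclidean_space \<Rightarrow> real) \<Rightarrow> bool" where
  "C_diff 0 f \<longleftrightarrow> continuous_on UNIV f"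
| "C_diff (Suc k) f \<longleftrightarrow> f differentiable_on UNIV \<and> (\<forall>b\<in>Basis. C_diff k (partial_deriv b f))"

definition test_function :: "'a::euclidean_space set \<Rightarrow> ('a \<Rightarrow> real) \<Rightarrow> bool" where
  "test_function \<Omega> \<phi> \<longleftrightarrow>
     (\<forall>k. C_diff k \<phi>) \<and> compact (closure {x. \<phi> x \<noteq> 0}) \<and> closure {x. \<phi> x \<noteq> 0} \<subseteq> \<Omega>"

definition has_weak_deriv :: "'a::euclidean_space set \<Rightarrow> 'a \<Rightarrow> 'a l2 \<Rightarrow> 'a l2 \<Rightarrow> bool" where
  "has_weak_deriv \<Omega> b u g \<longleftrightarrow> u \<in> L2 \<Omega> \<and> g \<in> L2 \<Omega> \<and>
     (\<forall>\<phi>. test_function \<Omega> \<phi> \<longrightarrow> u \<bullet> abs_l2 (partial_deriv b \<phi>) = - (g \<bullet> abs_l2 \<phi>))"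

definition weak_deriv :: "'a::euclidean_space set \<Rightarrow> 'a \<Rightarrow> 'a l2 \<Rightarrow> 'a l2" where
  "weak_deriv \<Omega> b u = (THE g. has_weak_deriv \<Omega> b u g)"

definition H1 :: "'a::euclidean_space set \<Rightarrow> 'a l2 set" where
  "H1 \<Omega> = {u \<in> L2 \<Omega>. \<forall>b\<in>Basis. \<exists>g. has_weak_deriv \<Omega> b u g}"

definition H2 :: "'a::euclidean_space set \<Rightarrow> 'a l2 set" where
  "H2 \<Omega> = {u \<in> H1 \<Omega>. \<forall>b\<in>Basis. weak_deriv \<Omega> b u \<in> H1 \<Omega>}"

text \<open>The form \<open>(\<nabla>w, \<nabla>v)\<close>, which on \<open>H01\<close> below is \<open>(A\<^sup>1\<^sup>/\<^sup>2 w, A\<^sup>1\<^sup>/\<^sup>2 v)\<close>.\<close>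

definition grad_form :: "'a::euclidean_space set \<Rightarrow> 'a l2 \<Rightarrow> 'a l2 \<Rightarrow> real" where
  "grad_form \<Omega> w v = (\<Sum>b\<in>Basis. weak_deriv \<Omega> b w \<bullet> weak_deriv \<Omega> b v)"

definition H1_seminorm :: "'a::euclidean_space set \<Rightarrow> 'a l2 \<Rightarrow> real" where
  "H1_seminorm \<Omega> v = sqrt (grad_form \<Omega> v v)"

definition H1_norm :: "'a::euclidean_space set \<Rightarrow> 'a l2 \<Rightarrow> real" where
  "H1_norm \<Omega> v = sqrt ((norm v)\<^sup>2 + (H1_seminorm \<Omega> v)\<^sup>2)"

definition H2_norm :: "'a::euclidean_space set \<Rightarrow> 'a l2 \<Rightarrow> real" where
  "H2_norm \<Omega> v = sqrt ((H1_norm \<Omega> v)\<^sup>2 +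
     (\<Sum>b\<in>Basis. \<Sum>c\<in>Basis. (norm (weak_deriv \<Omega> b (weak_deriv \<Omega> c v)))\<^sup>2))"

definition H01 :: "'a::euclidean_space set \<Rightarrow> 'a l2 set" where
  "H01 \<Omega> = {u \<in> H1 \<Omega>. \<forall>\<epsilon>>0. \<exists>\<phi>. test_function \<Omega> \<phi> \<and> H1_norm \<Omega> (u - abs_l2 \<phi>) < \<epsilon>}"


section \<open>The Dirichlet Laplacian\<close>

definition bounded_domain :: "'a::euclidean_space set \<Rightarrow> bool" where
  "bounded_domain \<Omega> \<longleftrightarrow> open \<Omega> \<and> connected \<Omega> \<and> bounded \<Omega> \<and> \<Omega> \<noteq> {}"

definition neg_laplacian :: "'a::euclidean_space set \<Rightarrow> 'a l2 \<Rightarrow> 'a l2" where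
  "neg_laplacian \<Omega> v = - (\<Sum>b\<in>Basis. weak_deriv \<Omega> b (weak_deriv \<Omega> b v))"

definition dirichlet_eigenvalue :: "'a::euclidean_space set \<Rightarrow> real \<Rightarrow> bool" where
  "dirichlet_eigenvalue \<Omega> \<mu> \<longleftrightarrow>
     (\<exists>v \<in> H2 \<Omega> \<inter> H01 \<Omega>. v \<noteq> 0 \<and> neg_laplacian \<Omega> v = \<mu> *\<^sub>R v)"

definition smallest_dirichlet_eigenvalue :: "'a::euclidean_space set \<Rightarrow> real \<Rightarrow> bool" where
  "smallest_dirichlet_eigenvalue \<Omega> lam1 \<longleftrightarrow>
     dirichlet_eigenvalue \<Omega> lam1 \<and> (\<forall>\<mu>. dirichlet_eigenvalue \<Omega> \<mu> \<longrightarrow> lam1 \<le> \<mu>)"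

text \<open>On domains where the Laplacian with domain \<open>H2 \<Omega> \<inter> H01 \<Omega>\<close> is self-adjoint (smooth or
  convex ones, for instance) this follows from \<open>lam1\<close> being its smallest eigenvalue.  On general
  bounded domains, such as nonconvex polygons, it does not: the eigenfunctions of the lowest
  eigenvalue of the self-adjoint Laplacian need not belong to \<open>H2 \<Omega>\<close>.\<close>

definition poincare_inequality :: "'a::euclidean_space set \<Rightarrow> real \<Rightarrow> bool" where
  "poincare_inequality \<Omega> lam1 \<longleftrightarrow>
     (\<forall>v \<in> H01 \<Omega>. (norm v)\<^sup>2 \<le> inverse lam1 * (H1_seminorm \<Omega> v)\<^sup>2)"


section \<open>Finite element spaces\<close>

definition mesh :: "'a::euclidean_space set \<Rightarrow> real \<Rightarrow> 'a set set \<Rightarrow> bool" where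
  "mesh \<Omega> h \<T> \<longleftrightarrow> triangulation \<T> \<and> \<T> \<noteq> {} \<and> (\<forall>K\<in>\<T>. int DIM('a) simplex K) \<and>
     \<Union>\<T> = closure \<Omega> \<and> h = Max (diameter ` \<T>)"

definition shape_regular :: "real set \<Rightarrow> (real \<Rightarrow> 'a::euclidean_space set set) \<Rightarrow> bool" where
  "shape_regular H \<T> \<longleftrightarrow>
     (\<exists>\<sigma>>0. \<forall>h\<in>H. \<forall>K\<in>\<T> h. \<exists>x. \<exists>r>0. ball x r \<subseteq> K \<and> diameter K \<le> \<sigma> * r)"

text \<open>\<open>H\<close> is the set of mesh sizes; the shape regularity and approximation constants do not
  depend on \<open>h \<in> H\<close>.\<close>

definition fe_family ::
  "'a::euclidean_space set \<Rightarrow> real set \<Rightarrow> (real \<Rightarrow> 'a set set) \<Rightarrow> (real \<Rightarrow> 'a l2 set) \<Rightarrow> bool" where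
  "fe_family \<Omega> H \<T> X \<longleftrightarrow>
     H \<subseteq> {0<..} \<and> (\<forall>h\<in>H. mesh \<Omega> h (\<T> h)) \<and> shape_regular H \<T> \<and>
     (\<forall>h\<in>H. subspace (X h) \<and> (\<exists>B. finite B \<and> X h = span B) \<and> X h \<subseteq> H01 \<Omega>) \<and>
     (\<exists>C. \<forall>h\<in>H. \<forall>\<psi> \<in> H2 \<Omega> \<inter> H01 \<Omega>.
        (INF \<psi>\<^sub>h \<in> X h. norm (\<psi> - \<psi>\<^sub>h) + h * H1_norm \<Omega> (\<psi> - \<psi>\<^sub>h)) \<le> C * h\<^sup>2 * H2_norm \<Omega> \<psi>)"


section \<open>The semidiscrete problem\<close>

definition semidiscrete_solution ::
  "'a::euclidean_space set \<Rightarrow> real \<Rightarrow> real \<Rightarrow> 'a l2 set \<Rightarrow> 'a l2 \<Rightarrow> 'a l2 \<Rightarrow>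
   (real \<Rightarrow> 'a l2) \<Rightarrow> (real \<Rightarrow> 'a l2) \<Rightarrow> (real \<Rightarrow> 'a l2) \<Rightarrow> bool" where
  "semidiscrete_solution \<Omega> \<alpha> \<beta> Xh u0 u1 u u' u'' \<longleftrightarrow>
     u0 \<in> Xh \<and> u1 \<in> Xh \<and> u 0 = u0 \<and> u' 0 = u1 \<and>
     (\<forall>t\<ge>0. u t \<in> Xh \<and>
        (u has_vector_derivative u' t) (at t within {0..}) \<and>
        (u' has_vector_derivative u'' t) (at t within {0..}) \<and>
        (\<forall>v\<in>Xh. u'' t \<bullet> v + \<beta> * grad_form \<Omega> (u' t) v + \<alpha> * (u' t \<bullet> v)
           + grad_form \<Omega> (u t) v = 0))"

definition energy ::
  "'a::euclidean_space set \<Rightarrow> (real \<Rightarrow> 'a l2) \<Rightarrow> (real \<Rightarrow> 'a l2) \<Rightarrow> real \<Rightarrow> real" where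
  "energy \<Omega> u u' t = 1 / 2 * ((norm (u' t))\<^sup>2 + (H1_seminorm \<Omega> (u t))\<^sup>2)"

end

theory Submission
  imports Defs
begin

text \<open>
  Let \<open>\<Gamma> = \<alpha> + \<beta> A\<^sub>h\<close> be the damping operator and consider
  \<open>V = \<parallel>u'\<parallel>\<^sup>2 + |u|\<^sub>1\<^sup>2 + 4 \<delta> (u', u - \<delta> \<Gamma>\<^sup>-\<^sup>1 u)\<close>. On a mode with eigenvalue \<open>\<lambda>\<close>, damping \<open>\<gamma> = \<alpha> + \<beta> \<lambda>\<close>
  and coefficient \<open>x\<close>, the quantity \<open>V' + 2 \<delta> V\<close> equals
  \<open>- 2 (1 - 2 \<delta> / \<gamma>) ((\<gamma> - \<delta>) (x' + \<delta> x)\<^sup>2 + \<delta> (\<lambda> - \<delta> \<gamma> + \<delta>\<^sup>2) x\<^sup>2)\<close>, which is nonpositive because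
  \<open>\<delta> \<le> min (\<gamma> / 2) (\<lambda> / \<gamma>)\<close>; both terms of the minimum increase with \<open>\<lambda>\<close>, so it suffices to
  assume this for the smallest eigenvalue. Moreover \<open>V\<close> lies between \<open>1/5\<close> and \<open>9/5\<close> times
  \<open>2 E\<^sub>h\<close>, whence \<open>E\<^sub>h(t) \<le> 9 e\<^sup>-\<^sup>2\<^sup>\<delta>\<^sup>t E\<^sub>h(0)\<close> in all cases. The modes only motivate \<open>V\<close>:
  everything is computed with bilinear forms and without diagonalising \<open>A\<^sub>h\<close>.

  That the form \<open>(\<nabla>w, \<nabla>v)\<close> is bilinear on \<open>H\<^sup>1\<close> rests on the uniqueness of weak derivatives, that is,
  on the fundamental lemma of the calculus of variations. Its test functions are products over the
  coordinates of \<open>exp (- 1 / t)\<close>, raised to the power \<open>1 / n\<close> and thus converging to the indicator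
  of a box.
\<close>

section \<open>Smooth functions supported in boxes\<close>

text \<open>For p = 1 this is exp (-1/t), extended by 0. Polynomial factors in 1/t are included so
  that the family is closed under differentiation.\<close>

definition flat :: "real poly \<Rightarrow> real \<Rightarrow> real" where
  "flat p t = (if t \<le> 0 then 0 else poly p (inverse t) * exp (- inverse t))"

lemma poly_div_exp_at_top: "((\<lambda>x::real. poly p x / exp x) \<longlongrightarrow> 0) at_top"
proof -
  have "((\<lambda>x. \<Sum>i\<le>degree p. coeff p i * (x ^ i / exp x)) \<longlongrightarrow> (\<Sum>i\<le>degree p. coeff p i * 0)) at_top"
    by (intro tendsto_intros tendsto_power_div_exp_0)
  then show ?thesis
    by (simp add: poly_altdef sum_divide_distrib)
qed

text \<open>With s = 1/t the derivative of p(s) exp (-s) is s^2 (p - p')(s) exp (-s), and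
  \<open>[:0, 0, 1:]\<close> is the factor s^2. At t = 0 the exponential beats every polynomial in
  s.\<close>

lemma has_real_derivative_flat:
  "(flat p has_real_derivative flat ([:0, 0, 1:] * (p - pderiv p)) t) (at t)"
proof (cases t "0::real" rule: linorder_cases)
  case less
  have "((\<lambda>_. 0) has_real_derivative 0) (at t)"
    by simp
  then have "(flat p has_real_derivative 0) (at t)"
    by (rule has_field_derivative_transform_within_open[where S = "{..<0}"])
      (use less in \<open>auto simp: flat_def\<close>)
  then show ?thesis
    using less by (simp add: flat_def)
next
  case greater
  have "((\<lambda>s. poly p (inverse s) * exp (- inverse s)) has_real_derivative
      flat ([:0, 0, 1:] * (p - pderiv p)) t) (at t)"
    by (rule derivative_eq_intros DERIV_chain2[OF poly_DERIV] refl | use greater in force)+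
      (use greater in \<open>simp add: flat_def power2_eq_square divide_simps\<close>,
       simp add: algebra_simps)
  then show ?thesis
    by (rule has_field_derivative_transform_within_open[where S = "{0<..}"])
      (use greater in \<open>auto simp: flat_def\<close>)
next
  case equal
  \<comment> \<open>The extra factor \<open>[:0, 1:]\<close> accounts for the division by s in the
    difference quotient.\<close>
  have "((\<lambda>s. poly ([:0, 1:] * p) (inverse s) / exp (inverse s)) \<longlongrightarrow> 0) (at_right 0)"
    by (rule filterlim_compose[OF poly_div_exp_at_top filterlim_inverse_at_top_right])
  then have "((\<lambda>s. (flat p s - flat p 0) / (s - 0)) \<longlongrightarrow> 0) (at_right 0)"
    by (rule filterlim_cong[THEN iffD1, rotated -1])
      (auto simp: flat_def eventually_at_filter exp_minus divide_simps)
  moreover have "((\<lambda>s. (flat p s - flat p 0) / (s - 0)) \<longlongrightarrow> 0) (at_left 0)"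
    by (rule tendsto_eventually) (auto simp: flat_def eventually_at_filter)
  ultimately have "((\<lambda>s. (flat p s - flat p 0) / (s - 0)) \<longlongrightarrow> 0) (at 0)"
    by (simp add: filterlim_split_at)
  then show ?thesis
    using equal by (simp add: has_field_derivative_iff flat_def)
qed

section \<open>Closure properties of C^k functions\<close>

lemma partial_deriv_eq:
  "(f has_derivative f') (at x) \<Longrightarrow> partial_deriv b f x = f' b"
  unfolding partial_deriv_def by (drule frechet_derivative_at) simp

lemma has_derivative_of_C_diff_Suc:
  assumes "C_diff (Suc k) f"
  shows "(f has_derivative frechet_derivative f (at x)) (at x)"
  using assms by (simp add: differentiable_on_def frechet_derivative_works)

lemma C_diff_SucD: "C_diff (Suc k) f \<Longrightarrow> C_diff k f"
proof (induction k arbitrary: f)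
  case 0
  then show ?case by (simp add: differentiable_imp_continuous_on)
next
  case (Suc k)
  have "C_diff k (partial_deriv b f)" if "b \<in> Basis" for b
    using Suc.IH Suc.prems that by (simp only: C_diff.simps(2)[of "Suc k"])
  with Suc.prems show ?case by simp
qed

lemma C_diff_const: "C_diff k (\<lambda>x. c)"
proof (induction k arbitrary: c)
  case (Suc k)
  have "partial_deriv b (\<lambda>x. c) = (\<lambda>x. 0)" for b :: 'a
    by (rule ext, rule partial_deriv_eq) simp
  with Suc show ?case by simp
qed simp

lemma C_diff_add:
  "C_diff k f \<Longrightarrow> C_diff k g \<Longrightarrow> C_diff k (\<lambda>x. f x + g x)"
proof (induction k arbitrary: f g)
  case (Suc k)
  have "partial_deriv b (\<lambda>x. f x + g x) = (\<lambda>x. partial_deriv b f x + partial_deriv b g x)" for b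
  proof (rule ext, rule partial_deriv_eq)
    fix x
    show "((\<lambda>x. f x + g x) has_derivative (\<lambda>b. partial_deriv b f x + partial_deriv b g x)) (at x)"
      unfolding partial_deriv_def using Suc.prems
      by (intro has_derivative_add has_derivative_of_C_diff_Suc)
  qed
  with Suc show ?case by simp
qed (simp add: continuous_on_add)

lemma C_diff_mult:
  "C_diff k f \<Longrightarrow> C_diff k g \<Longrightarrow> C_diff k (\<lambda>x. f x * g x)"
proof (induction k arbitrary: f g)
  case (Suc k)
  have *: "partial_deriv b (\<lambda>x. f x * g x) = (\<lambda>x. f x * partial_deriv b g x + partial_deriv b f x * g x)"
    for b
  proof (rule ext, rule partial_deriv_eq)
    fix x
    show "((\<lambda>x. f x * g x) has_derivative (\<lambda>b. f x * partial_deriv b g x + partial_deriv b f x * g x)) (at x)"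
      unfolding partial_deriv_def using Suc.prems
      by (intro has_derivative_mult has_derivative_of_C_diff_Suc)
  qed
  have "C_diff k f" "C_diff k g"
    using Suc.prems by (simp_all only: C_diff_SucD)
  with Suc have "\<forall>b\<in>Basis. C_diff k (partial_deriv b (\<lambda>x. f x * g x))"
    by (auto simp: * intro!: C_diff_add)
  moreover have "(\<lambda>x. f x * g x) differentiable_on UNIV"
    using Suc.prems by (simp add: differentiable_on_mult)
  ultimately show ?case by simp
qed (simp add: continuous_on_mult)

lemma C_diff_prod: "(\<And>i. i \<in> I \<Longrightarrow> C_diff k (f i)) \<Longrightarrow> C_diff k (\<lambda>x. \<Prod>i\<in>I. f i x)"
  by (induction I rule: infinite_finite_induct) (auto intro: C_diff_const C_diff_mult)

text \<open>The polynomial varies in the induction, because each partial derivative is a constant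
  multiple of \<open>flat\<close> for another polynomial.\<close>

lemma C_diff_flat: "C_diff k (\<lambda>x. flat p (x \<bullet> v + s))"
proof (induction k arbitrary: p)
  have D: "((\<lambda>x. flat p (x \<bullet> v + s)) has_derivative
      (\<lambda>b. (b \<bullet> v) * flat ([:0, 0, 1:] * (p - pderiv p)) (x \<bullet> v + s))) (at x)" for p x
    by (rule has_derivative_eq_rhs,
        rule has_derivative_compose[OF _ has_real_derivative_flat[THEN has_field_derivative_imp_has_derivative]])
      (auto intro!: derivative_eq_intros)
  {
    case 0
    show ?case
      unfolding C_diff.simps
      by (rule has_derivative_continuous_on, rule has_derivative_at_withinI, rule D)
  next
    case (Suc k)
    have "partial_deriv b (\<lambda>x. flat p (x \<bullet> v + s)) =
        (\<lambda>x. (b \<bullet> v) * flat ([:0, 0, 1:] * (p - pderiv p)) (x \<bullet> v + s))" for b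
      by (rule ext, rule partial_deriv_eq) (rule D)
    moreover have "(\<lambda>x. flat p (x \<bullet> v + s)) differentiable_on UNIV"
      using D[of p] by (auto simp: differentiable_on_def differentiable_def)
    ultimately show ?case
      using Suc.IH by (simp add: C_diff_mult C_diff_const)
  }
qed

section \<open>Smooth bumps on boxes\<close>

text \<open>Scaling the argument by \<open>Suc n\<close> takes the root of order n + 1 of exp
  (-1/t), so the bumps rise to 1 inside the box while their support stays put. \<open>Suc\<close>
  keeps the scaling positive at n = 0.\<close>

definition box_bump :: "nat \<Rightarrow> 'a::euclidean_space \<Rightarrow> 'a \<Rightarrow> 'a \<Rightarrow> real" where
  "box_bump n a b x =
     (\<Prod>i\<in>Basis. flat 1 (real (Suc n) * (x \<bullet> i - a \<bullet> i)) * flat 1 (real (Suc n) * (b \<bullet> i - x \<bullet> i)))"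

lemma flat_one_bounds: "0 \<le> flat 1 t" "flat 1 t \<le> 1"
  by (auto simp: flat_def)

lemma flat_one_eq_0_iff: "flat 1 t = 0 \<longleftrightarrow> t \<le> 0"
  by (simp add: flat_def)

lemma box_bump_eq_0_iff: "box_bump n a b x = 0 \<longleftrightarrow> x \<notin> box a b"
  by (auto simp: box_bump_def mem_box flat_one_eq_0_iff mult_le_0_iff not_less not_le
      simp del: of_nat_Suc)

lemma box_bump_nonneg: "0 \<le> box_bump n a b x"
  unfolding box_bump_def by (intro prod_nonneg ballI mult_nonneg_nonneg flat_one_bounds)

lemma box_bump_le_1: "box_bump n a b x \<le> 1"
  unfolding box_bump_def
  by (intro prod_le_1 conjI mult_nonneg_nonneg mult_le_one flat_one_bounds)

lemma box_bump_tendsto: "(\<lambda>n. box_bump n a b x) \<longlonglongrightarrow> indicator (box a b) x"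
proof (cases "x \<in> box a b")
  case False
  then have "box_bump n a b x = 0" for n by (simp add: box_bump_eq_0_iff)
  with False show ?thesis by simp
next
  case True
  have *: "(\<lambda>n. flat 1 (real (Suc n) * t)) \<longlonglongrightarrow> 1" if "t > 0" for t
  proof -
    have "(\<lambda>n. exp (- (inverse t * inverse (real (Suc n))))) \<longlonglongrightarrow> exp (- (inverse t * 0))"
      by (intro tendsto_intros LIMSEQ_inverse_real_of_nat)
    moreover have "flat 1 (real (Suc n) * t) = exp (- (inverse t * inverse (real (Suc n))))" for n
      using that by (simp add: flat_def mult_le_0_iff del: of_nat_Suc)
    ultimately show ?thesis by (simp del: of_nat_Suc)
  qed
  have "(\<lambda>n. box_bump n a b x) \<longlonglongrightarrow> (\<Prod>i\<in>(Basis::'a set). 1 * 1)"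
    unfolding box_bump_def using True
    by (intro tendsto_prod tendsto_mult *) (auto simp: mem_box)
  with True show ?thesis by simp
qed

lemma C_diff_box_bump: "C_diff k (box_bump n a b)"
proof -
  have 1: "flat 1 (real (Suc n) * (x \<bullet> i - a \<bullet> i)) =
      flat 1 (x \<bullet> (real (Suc n) *\<^sub>R i) + - real (Suc n) * (a \<bullet> i))" for x i :: 'a
    by (simp add: algebra_simps del: of_nat_Suc)
  have 2: "flat 1 (real (Suc n) * (b \<bullet> i - x \<bullet> i)) =
      flat 1 (x \<bullet> (- real (Suc n) *\<^sub>R i) + real (Suc n) * (b \<bullet> i))" for x i :: 'a
    by (simp add: algebra_simps del: of_nat_Suc)
  show ?thesis
    unfolding box_bump_def[abs_def] 1 2
    by (intro C_diff_prod C_diff_mult C_diff_flat)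
qed

lemma test_function_box_bump:
  assumes "cbox a b \<subseteq> \<Omega>"
  shows "test_function \<Omega> (box_bump n a b)"
proof -
  have "closure {x. box_bump n a b x \<noteq> 0} \<subseteq> cbox a b"
    by (rule closure_minimal) (use box_subset_cbox in \<open>auto simp: box_bump_eq_0_iff\<close>)
  with assms show ?thesis
    unfolding test_function_def
    by (auto intro: C_diff_box_bump simp: compact_closure bounded_subset[OF bounded_box] box_bump_eq_0_iff)
qed

lemma borel_measurable_box_bump [measurable]: "box_bump n a b \<in> borel_measurable borel"
  using C_diff_box_bump[of 0 n a b] by (simp add: borel_measurable_continuous_onI)

lemma square_integrable_indicator_box: "square_integrable (indicator (box a b))"
  by (auto simp: square_integrable_def emeasure_lborel_box_eq power2_eq_square
      simp flip: indicator_inter_arith intro!: integrable_real_indicator)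

lemma square_integrable_box_bump: "square_integrable (box_bump n a b)"
  unfolding square_integrable_def
proof
  have *: "(box_bump n a b x)\<^sup>2 \<le> (indicator (box a b) x)\<^sup>2" for x
    using box_bump_eq_0_iff[of n a b x] box_bump_nonneg[of n a b x] box_bump_le_1[of n a b x]
    by (cases "x \<in> box a b") (auto simp: power_le_one)
  show "integrable lborel (\<lambda>x. (box_bump n a b x)\<^sup>2)"
    by (rule Bochner_Integration.integrable_bound[of _ "\<lambda>x. (indicator (box a b) x)\<^sup>2"])
      (use square_integrable_indicator_box[of a b] * in \<open>auto simp: square_integrable_def\<close>)
qed simp

section \<open>Uniqueness of weak derivatives\<close>

text \<open>Open boxes form an intersection-stable generator of the Borel sets, so a Dynkin argument
  extends the vanishing of integrals to all Borel sets. The complement step rests on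
  \<open>tot\<close>, since the whole space is not a box.\<close>

lemma AE_zero_if_box_integrals_zero:
  fixes f :: "'a::euclidean_space \<Rightarrow> real"
  assumes f: "integrable lborel f"
    and tot: "integral\<^sup>L lborel f = 0"
    and box: "\<And>a b. (LINT x:box a b|lborel. f x) = 0"
  shows "AE x in lborel. f x = 0"
proof (rule density_unique_real[OF f])
  show "integrable lborel (\<lambda>x::'a. 0::real)"
    by simp
  fix A :: "'a set"
  assume "A \<in> sets lborel"
  have int: "set_integrable lborel B f" if "B \<in> sets lborel" for B
    unfolding set_integrable_def by (rule integrable_mult_indicator[OF that f])
  have "Int_stable (range (\<lambda>(a, b). box a b :: 'a set))"
    by (auto simp: Int_stable_def box_Int_box)
  moreover have "range (\<lambda>(a, b). box a b :: 'a set) \<subseteq> Pow UNIV"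
    by auto
  moreover have "A \<in> sigma_sets UNIV (range (\<lambda>(a, b). box a b))"
    using \<open>A \<in> sets lborel\<close> by (simp add: borel_eq_box)
  ultimately have "(LINT x:A|lborel. f x) = 0"
  proof (induction rule: sigma_sets_induct_disjoint)
    case (basic A)
    then show ?case using box by auto
  next
    case empty
    show ?case by (simp add: set_lebesgue_integral_def)
  next
    case (compl A)
    then have A: "A \<in> sets lborel" by (simp add: borel_eq_box)
    have "(LINT x:(UNIV - A) \<union> A|lborel. f x) = (LINT x:UNIV - A|lborel. f x) + (LINT x:A|lborel. f x)"
      using A by (intro set_integral_Un int) auto
    with compl.IH tot show ?case by (simp add: set_lebesgue_integral_def)
  next
    case (union F)
    then have F: "F i \<in> sets lborel" for i by (auto simp: borel_eq_box)
    have "(LINT x:(\<Union>i. F i)|lborel. f x) = (\<Sum>i. LINT x:F i|lborel. f x)"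
      using union.hyps F
      by (intro lebesgue_integral_countable_add int sets.countable_nat_UN)
        (auto simp: disjoint_family_on_def)
    with union.IH show ?case by simp
  qed
  then show "(LINT x:A|lborel. f x) = (LINT x:A|lborel. 0)"
    by (simp add: set_lebesgue_integral_def)
qed

text \<open>Dominated convergence turns orthogonality to bumps into vanishing integrals over boxes.
  A countable cover of \<Omega> by closed boxes then makes the local conclusion global.\<close>

lemma AE_zero_if_bump_orthogonal:
  fixes g :: "'a::euclidean_space \<Rightarrow> real"
  assumes "open \<Omega>" and g: "square_integrable g"
    and bump: "\<And>n a b. cbox a b \<subseteq> \<Omega> \<Longrightarrow> integral\<^sup>L lborel (\<lambda>x. g x * box_bump n a b x) = 0"
  shows "AE x in lborel. x \<in> \<Omega> \<longrightarrow> g x = 0"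
proof -
  have g_meas [measurable]: "g \<in> borel_measurable borel"
    using g by (simp add: square_integrable_def)
  have g_box: "integrable lborel (\<lambda>x. g x * indicator (box a b) x)" for a b
    by (rule square_integrable_mult[OF g square_integrable_indicator_box])
  have zero: "integral\<^sup>L lborel (\<lambda>x. g x * indicator (box a b) x) = 0" if "cbox a b \<subseteq> \<Omega>" for a b
  proof -
    have "(\<lambda>n. integral\<^sup>L lborel (\<lambda>x. g x * box_bump n a b x))
        \<longlonglongrightarrow> integral\<^sup>L lborel (\<lambda>x. g x * indicator (box a b) x)"
    proof (rule integral_dominated_convergence[where w = "\<lambda>x. \<bar>g x * indicator (box a b) x\<bar>"])
      show "AE x in lborel. norm (g x * box_bump n a b x) \<le> \<bar>g x * indicator (box a b) x\<bar>" for n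
      proof (intro always_eventually allI)
        fix x
        show "norm (g x * box_bump n a b x) \<le> \<bar>g x * indicator (box a b) x\<bar>"
          using box_bump_nonneg[of n a b x] box_bump_le_1[of n a b x] box_bump_eq_0_iff[of n a b x]
          by (cases "x \<in> box a b") (auto simp: abs_mult mult_left_le)
      qed
      show "AE x in lborel. (\<lambda>n. g x * box_bump n a b x) \<longlonglongrightarrow> g x * indicator (box a b) x"
        by (intro always_eventually allI tendsto_intros box_bump_tendsto)
    qed (use g_box in \<open>auto simp del: abs_mult\<close>)
    then show ?thesis
      using that by (simp add: bump LIMSEQ_const_iff)
  qed
  have AE_cbox: "AE x in lborel. x \<in> cbox a b \<longrightarrow> g x = 0" if sub: "cbox a b \<subseteq> \<Omega>" for a b
  proof -
    have "AE x in lborel. g x * indicator (box a b) x = 0"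
    \<comment> \<open>The cutoff of g to the box is integrable. Its integral over another box is
      that of g over the intersection, again a box whose closed version lies in \<Omega>.\<close>
    proof (rule AE_zero_if_box_integrals_zero[OF g_box zero[OF sub]])
      fix c d :: 'a
      obtain p q where pq: "box c d \<inter> box a b = box p q" and "cbox p q \<subseteq> cbox a b"
        by (rule that[of "\<Sum>i\<in>Basis. max (c \<bullet> i) (a \<bullet> i) *\<^sub>R i" "\<Sum>i\<in>Basis. min (d \<bullet> i) (b \<bullet> i) *\<^sub>R i"])
          (auto simp: box_Int_box mem_box)
      then have "integral\<^sup>L lborel (\<lambda>x. g x * indicator (box p q) x) = 0"
        using zero sub by blast
      then show "(LINT x:box c d|lborel. g x * indicator (box a b) x) = 0"
        by (simp add: set_lebesgue_integral_def mult_ac Int_commute flip: pq indicator_inter_arith)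
    qed
    \<comment> \<open>Open and closed boxes have equal measure, so the faces are negligible.\<close>
    moreover have "AE x in lborel. x \<notin> cbox a b - box a b"
    proof (rule AE_not_in)
      have "emeasure lborel (cbox a b - box a b) = emeasure lborel (cbox a b) - emeasure lborel (box a b)"
        by (rule emeasure_Diff) (use box_subset_cbox in \<open>auto simp: emeasure_lborel_box_eq\<close>)
      also have "\<dots> = 0"
        by (auto simp: emeasure_lborel_box_eq emeasure_lborel_cbox_eq)
      finally show "cbox a b - box a b \<in> null_sets lborel" by auto
    qed
    ultimately show ?thesis
      by eventually_elim auto
  qed
  obtain \<D> where \<D>: "countable \<D>" "\<D> \<subseteq> Pow \<Omega>" "\<And>X. X \<in> \<D> \<Longrightarrow> \<exists>a b. X = cbox a b" "\<Union>\<D> = \<Omega>"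
    using open_countable_Union_open_cbox[OF \<open>open \<Omega>\<close>] by metis
  have "AE x in lborel. \<forall>X\<in>\<D>. x \<in> X \<longrightarrow> g x = 0"
    unfolding AE_ball_countable[OF \<D>(1)]
    using \<D>(2,3) AE_cbox by blast
  then show ?thesis
    by eventually_elim (use \<D>(4) in blast)
qed

text \<open>The fundamental lemma of the calculus of variations: the bumps force f to vanish on
  \<Omega>, and membership in \<open>L2\<close> settles the outside.\<close>

lemma L2_eq_0_if_orthogonal_test_functions:
  assumes "open \<Omega>" "f \<in> L2 \<Omega>"
    and orth: "\<And>\<phi>. test_function \<Omega> \<phi> \<Longrightarrow> f \<bullet> abs_l2 \<phi> = 0"
  shows "f = 0"
proof -
  obtain g where g: "square_integrable g" and f: "f = abs_l2 g"
    using Quotient_abs_rep[OF Quotient_l2, of f] Quotient_rep_reflp[OF Quotient_l2, of f] by auto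
  have "integral\<^sup>L lborel (\<lambda>x. g x * box_bump n a b x) = 0" if "cbox a b \<subseteq> \<Omega>" for n a b
    using orth[OF test_function_box_bump[OF that, of n]] g square_integrable_box_bump[of n a b]
    by (simp add: f inner_l2.abs_eq)
  then have "AE x in lborel. x \<in> \<Omega> \<longrightarrow> g x = 0"
    using assms(1) g by (rule AE_zero_if_bump_orthogonal[rotated 2])
  moreover have "AE x in lborel. x \<notin> \<Omega> \<longrightarrow> g x = 0"
    using assms(2) g by (simp add: f L2_def vanishes_outside.abs_eq)
  ultimately have "AE x in lborel. g x = 0"
    by eventually_elim auto
  then show ?thesis
    using g unfolding f zero_l2_def
    by (intro Quotient_rel_abs[OF Quotient_l2]) (simp add: square_integrable_zero)
qed

lemma subspace_L2: "subspace (L2 \<Omega>)"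
proof (rule subspaceI)
  show "0 \<in> L2 \<Omega>"
    unfolding L2_def mem_Collect_eq by transfer (auto simp: square_integrable_zero)
  show "f + g \<in> L2 \<Omega>" if "f \<in> L2 \<Omega>" "g \<in> L2 \<Omega>" for f g
    using that unfolding L2_def mem_Collect_eq by transfer auto
  show "c *\<^sub>R f \<in> L2 \<Omega>" if "f \<in> L2 \<Omega>" for c f
    using that unfolding L2_def mem_Collect_eq by transfer auto
qed

lemma has_weak_deriv_unique:
  assumes "open \<Omega>" "has_weak_deriv \<Omega> b u g" "has_weak_deriv \<Omega> b u g'"
  shows "g = g'"
proof -
  have "g - g' = 0"
  proof (rule L2_eq_0_if_orthogonal_test_functions[OF assms(1)])
    show "g - g' \<in> L2 \<Omega>"
      using assms(2,3) by (auto simp: has_weak_deriv_def subspace_diff[OF subspace_L2])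
    show "(g - g') \<bullet> abs_l2 \<phi> = 0" if "test_function \<Omega> \<phi>" for \<phi>
      using assms(2,3) that unfolding has_weak_deriv_def by (auto simp: inner_diff_left)
  qed
  then show ?thesis by simp
qed


lemma weak_deriv_eq:
  assumes "open \<Omega>" "has_weak_deriv \<Omega> b u g"
  shows "weak_deriv \<Omega> b u = g"
  unfolding weak_deriv_def using assms has_weak_deriv_unique by blast

lemma has_weak_deriv_weak_deriv:
  assumes "open \<Omega>" "u \<in> H1 \<Omega>" "b \<in> Basis"
  shows "has_weak_deriv \<Omega> b u (weak_deriv \<Omega> b u)"
  using assms weak_deriv_eq by (fastforce simp: H1_def)

section \<open>Linearity of weak derivatives and of the gradient form\<close>

lemma has_weak_deriv_add:
  "has_weak_deriv \<Omega> b u g \<Longrightarrow> has_weak_deriv \<Omega> b v k \<Longrightarrow> has_weak_deriv \<Omega> b (u + v) (g + k)"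
  by (auto simp: has_weak_deriv_def inner_add_left subspace_add[OF subspace_L2])

lemma has_weak_deriv_scaleR:
  "has_weak_deriv \<Omega> b u g \<Longrightarrow> has_weak_deriv \<Omega> b (c *\<^sub>R u) (c *\<^sub>R g)"
  by (auto simp: has_weak_deriv_def subspace_scale[OF subspace_L2])

lemma grad_form_commute: "grad_form \<Omega> u v = grad_form \<Omega> v u"
  by (simp add: grad_form_def inner_commute)

lemma grad_form_add_left:
  assumes "open \<Omega>" "u \<in> H1 \<Omega>" "v \<in> H1 \<Omega>"
  shows "grad_form \<Omega> (u + v) w = grad_form \<Omega> u w + grad_form \<Omega> v w"
proof -
  have "weak_deriv \<Omega> b (u + v) = weak_deriv \<Omega> b u + weak_deriv \<Omega> b v" if "b \<in> Basis" for b
    using that assms by (intro weak_deriv_eq has_weak_deriv_add has_weak_deriv_weak_deriv)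
  then show ?thesis
    by (simp add: grad_form_def inner_add_left sum.distrib)
qed

lemma grad_form_scaleR_left:
  assumes "open \<Omega>" "u \<in> H1 \<Omega>"
  shows "grad_form \<Omega> (c *\<^sub>R u) w = c * grad_form \<Omega> u w"
proof -
  have "weak_deriv \<Omega> b (c *\<^sub>R u) = c *\<^sub>R weak_deriv \<Omega> b u" if "b \<in> Basis" for b
    using that assms by (intro weak_deriv_eq has_weak_deriv_scaleR has_weak_deriv_weak_deriv)
  then show ?thesis
    by (simp add: grad_form_def sum_distrib_left)
qed

lemma H1_seminorm_sq: "(H1_seminorm \<Omega> v)\<^sup>2 = grad_form \<Omega> v v"
  by (simp add: H1_seminorm_def grad_form_def sum_nonneg)

section \<open>Symmetric forms on finite-dimensional subspaces\<close>

text \<open>The laws are confined to X because the gradient form is shown to be bilinear only on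
  functions with weak derivatives.\<close>

locale symmetric_form =
  fixes X :: "'b::real_inner set" and a :: "'b \<Rightarrow> 'b \<Rightarrow> real"
  assumes subspace: "subspace X"
    and commute: "\<lbrakk>u \<in> X; v \<in> X\<rbrakk> \<Longrightarrow> a u v = a v u"
    and add_left: "\<lbrakk>u \<in> X; v \<in> X; w \<in> X\<rbrakk> \<Longrightarrow> a (u + v) w = a u w + a v w"
    and scale_left: "\<lbrakk>u \<in> X; w \<in> X\<rbrakk> \<Longrightarrow> a (k *\<^sub>R u) w = k * a u w"
begin

lemma X_closed:
  "u \<in> X \<Longrightarrow> v \<in> X \<Longrightarrow> u + v \<in> X" "u \<in> X \<Longrightarrow> v \<in> X \<Longrightarrow> u - v \<in> X" "u \<in> X \<Longrightarrow> k *\<^sub>R u \<in> X"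
  using subspace by (simp_all add: subspace_add subspace_diff subspace_scale)

lemma diff_left: "\<lbrakk>u \<in> X; v \<in> X; w \<in> X\<rbrakk> \<Longrightarrow> a (u - v) w = a u w - a v w"
  using add_left[of u "(-1) *\<^sub>R v" w] scale_left[of v w "-1"] X_closed(3)[of v "-1"] by simp

lemma add_right: "\<lbrakk>u \<in> X; v \<in> X; w \<in> X\<rbrakk> \<Longrightarrow> a w (u + v) = a w u + a w v"
  using add_left[of u v w] by (simp add: X_closed commute[of w])

lemma diff_right: "\<lbrakk>u \<in> X; v \<in> X; w \<in> X\<rbrakk> \<Longrightarrow> a w (u - v) = a w u - a w v"
  using diff_left[of u v w] by (simp add: X_closed commute[of w])

lemma scale_right: "\<lbrakk>u \<in> X; w \<in> X\<rbrakk> \<Longrightarrow> a w (k *\<^sub>R u) = k * a w u"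
  using scale_left[of u w k] by (simp add: X_closed commute[of w])

lemmas bilinear = add_left diff_left scale_left add_right diff_right scale_right

lemma zero_left: "w \<in> X \<Longrightarrow> a 0 w = 0"
  using scale_left[of 0 w 0] subspace_0[OF subspace] by simp

lemma sum_left:
  assumes "\<And>e. e \<in> E \<Longrightarrow> f e \<in> X" "w \<in> X"
  shows "a (\<Sum>e\<in>E. f e) w = (\<Sum>e\<in>E. a (f e) w)"
  using assms(1)
proof (induction E rule: infinite_finite_induct)
  case (insert e E)
  moreover from insert have "(\<Sum>e\<in>E. f e) \<in> X"
    by (intro subspace_sum[OF subspace]) auto
  ultimately show ?case
    using assms(2) by (simp add: add_left)
qed (simp_all add: zero_left assms(2))

text \<open>Gram-Schmidt with respect to \<open>a\<close>, one spanning vector at a time.\<close>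

lemma orthonormal_basis_exists:
  assumes pos: "\<And>v. v \<in> X \<Longrightarrow> v \<noteq> 0 \<Longrightarrow> a v v > 0"
    and "finite B" "B \<subseteq> X"
  shows "\<exists>E. finite E \<and> E \<subseteq> X \<and> (\<forall>e\<in>E. \<forall>e'\<in>E. a e e' = (if e = e' then 1 else 0)) \<and>
    (\<forall>w\<in>span B. (\<Sum>e\<in>E. a w e *\<^sub>R e) = w)"
  using assms(2,3)
proof (induction B rule: finite_induct)
  case empty
  show ?case by (intro exI[of _ "{}"]) simp
next
  case (insert b B)
  then have b: "b \<in> X" and B: "B \<subseteq> X"
    by auto
  from insert.IH[OF B] obtain E where E: "finite E" "E \<subseteq> X"
    and E_orth: "\<forall>e\<in>E. \<forall>e'\<in>E. a e e' = (if e = e' then 1 else 0)"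
    and exp: "\<forall>w\<in>span B. (\<Sum>e\<in>E. a w e *\<^sub>R e) = w"
    by blast
  define r where "r = b - (\<Sum>e\<in>E. a b e *\<^sub>R e)"
  have sumX: "(\<Sum>e\<in>E. f e *\<^sub>R e) \<in> X" for f :: "'b \<Rightarrow> real"
    using E(2) by (auto intro!: subspace_sum[OF subspace] X_closed)
  have r: "r \<in> X"
    unfolding r_def using b sumX by (intro X_closed)
  have sum_orth: "a (\<Sum>e\<in>E. f e *\<^sub>R e) w = (\<Sum>e\<in>E. f e * a e w)" if "w \<in> X" for f w
    using E(2) that by (subst sum_left) (auto simp: scale_left X_closed intro!: sum.cong)
  have r_orth: "a r e = 0" if "e \<in> E" for e
  proof -
    have "(\<Sum>e'\<in>E. a b e' * a e' e) = (\<Sum>e'\<in>E. if e' = e then a b e else 0)"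
      using that E_orth by (intro sum.cong) auto
    then show ?thesis
      using that E b sumX by (auto simp: r_def diff_left sum_orth)
  qed
  have r_orth': "a e r = 0" if "e \<in> E" for e
    using r_orth[OF that] that r E(2) commute[of e r] by auto
  \<comment> \<open>R holds the normalised residual, or nothing when b is already a combination of
    E.\<close>
  define R where "R = (if r = 0 then {} else {(1 / sqrt (a r r)) *\<^sub>R r})"
  have R: "finite R" "R \<subseteq> X"
    using r by (auto simp: R_def X_closed)
  have R_orth: "a e f = 0" "a f e = 0" if "e \<in> E" "f \<in> R" for e f
    using that r_orth[of e] r E(2) commute[of e r]
    by (auto simp: R_def scale_left scale_right split: if_splits)
  have R_one: "a e f = (if e = f then 1 else 0)" if "e \<in> R" "f \<in> R" for e f
    using that r pos[OF r] by (auto simp: R_def bilinear X_closed split: if_splits)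
  have disj: "E \<inter> R = {}"
    using R_orth(1) R_one by fastforce
  have span: "w \<in> X \<and> (\<Sum>e\<in>E \<union> R. a w e *\<^sub>R e) = w" if "w \<in> span (insert b B)" for w
    using that
  proof (induction w rule: span_induct_alt)
    case base
    show ?case
      using E(2) R(2) subspace_0[OF subspace] by (auto simp: zero_left intro!: sum.neutral)
  next
    case (step c x y)
    then have yX: "y \<in> X" and xX: "x \<in> X"
      using b B by auto
    have "(\<Sum>e\<in>E \<union> R. a x e *\<^sub>R e) = x"
    proof (cases "x \<in> B")
      case True
      \<comment> \<open>Vectors of B are combinations of E, hence have no component along R.\<close>
      have "a x f = 0" if "f \<in> R" for f
      proof -
        have "a x f = a (\<Sum>e\<in>E. a x e *\<^sub>R e) f"
          using bspec[OF exp, of x] True by (simp add: span_base)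
        also have "\<dots> = 0"
          using that R(2) R_orth by (subst sum_orth) auto
        finally show ?thesis .
      qed
      then show ?thesis
        using bspec[OF exp, of x] True E(1) R(1) disj by (simp add: sum.union_disjoint span_base)
    next
      case False
      then have x: "x = b" using step.hyps by auto
      \<comment> \<open>The coefficient of b along the normalised residual is thus sqrt (a r r),
        which reproduces r.\<close>
      have "a b r = a r r"
      proof -
        have "a (\<Sum>e\<in>E. a b e *\<^sub>R e) r = 0"
          using r r_orth' by (subst sum_orth) auto
        then show ?thesis
          using diff_left[of b "\<Sum>e\<in>E. a b e *\<^sub>R e" r] b sumX r by (simp flip: r_def)
      qed
      then have "(\<Sum>e\<in>R. a b e *\<^sub>R e) = r"
        using r b pos[OF r] by (auto simp: R_def scale_right real_sqrt_divide field_simps)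
      then show ?thesis
        using E(1) R(1) disj by (simp add: sum.union_disjoint x r_def)
    qed
    moreover have "a (c *\<^sub>R x + y) e = c * a x e + a y e" if "e \<in> E \<union> R" for e
      using that E(2) R(2) yX xX by (auto simp: add_left scale_left X_closed)
    ultimately show ?case
      using step.IH yX xX
      by (simp add: X_closed scaleR_add_left sum.distrib flip: scaleR_scaleR scaleR_sum_right)
  qed
  show ?case
    using E E_orth R R_orth R_one disj span
    by (intro exI[of _ "E \<union> R"]) auto
qed

end

section \<open>Differentiating curves in a finite-dimensional subspace\<close>

lemma symmetric_form_inner: "subspace X \<Longrightarrow> symmetric_form X (\<lambda>u v. u \<bullet> v)"
  by unfold_locales (auto simp: inner_add_left inner_commute inner_add_right)

text \<open>The expansion of u in an orthonormal basis is differentiated coefficientwise. This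
  places the velocity in X, which the notion of solution does not state.\<close>

lemma has_vector_derivative_in_span:
  fixes u :: "real \<Rightarrow> 'b::real_inner"
  assumes "finite B" and u: "\<And>t. t \<ge> 0 \<Longrightarrow> u t \<in> span B"
    and u': "(u has_vector_derivative u') (at t within {0..})" and "t \<ge> 0"
  shows "u' \<in> span B"
proof -
  obtain E where E: "finite E" "E \<subseteq> span B" "\<And>w. w \<in> span B \<Longrightarrow> (\<Sum>e\<in>E. (w \<bullet> e) *\<^sub>R e) = w"
    using symmetric_form.orthonormal_basis_exists[OF symmetric_form_inner[OF subspace_span[of B]] _ \<open>finite B\<close>]
    by (auto simp: span_superset)
  have "((\<lambda>t. \<Sum>e\<in>E. (u t \<bullet> e) *\<^sub>R e) has_vector_derivative (\<Sum>e\<in>E. (u' \<bullet> e) *\<^sub>R e)) (at t within {0..})"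
    by (intro has_vector_derivative_sum
        bounded_linear.has_vector_derivative[OF bounded_linear_scaleR_left]
        bounded_linear.has_vector_derivative[OF bounded_linear_inner_left] u')
  then have "(u has_vector_derivative (\<Sum>e\<in>E. (u' \<bullet> e) *\<^sub>R e)) (at t within {0..})"
    by (rule has_vector_derivative_transform[rotated 2]) (use E(3) u \<open>t \<ge> 0\<close> in auto)
  \<comment> \<open>Derivatives are unique at limit points only; points to the right of t serve also
    for t = 0.\<close>
  moreover have "at t within {0..} \<noteq> bot"
    using at_le[of "{t<..}" "{0..}" t] \<open>t \<ge> 0\<close> trivial_limit_at_right_real[of t]
    by (metis atLeast_subset_iff bot_unique greaterThan_subset_iff Ioi_le_Ico order_trans)
  ultimately have "u' = (\<Sum>e\<in>E. (u' \<bullet> e) *\<^sub>R e)"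
    using u' vector_derivative_unique_within by blast
  also have "\<dots> \<in> span B"
    using E(2) by (intro span_sum span_scale) auto
  finally show ?thesis .
qed

text \<open>No continuity of \<open>a\<close> is assumed. Expanding both arguments in an orthonormal
  basis turns the form into a finite sum of products of scalar functions.\<close>

lemma (in symmetric_form) has_real_derivative_form:
  assumes "finite B" "X = span B"
    and u: "\<And>t. t \<ge> 0 \<Longrightarrow> u t \<in> X" and v: "\<And>t. t \<ge> 0 \<Longrightarrow> v t \<in> X"
    and u': "(u has_vector_derivative u') (at t within {0..})"
    and v': "(v has_vector_derivative v') (at t within {0..})" and "t \<ge> 0"
  shows "((\<lambda>t. a (u t) (v t)) has_real_derivative a u' (v t) + a (u t) v') (at t within {0..})"
proof -
  obtain E where E: "finite E" "E \<subseteq> X" "\<And>w. w \<in> X \<Longrightarrow> (\<Sum>e\<in>E. (w \<bullet> e) *\<^sub>R e) = w"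
    using symmetric_form.orthonormal_basis_exists[OF symmetric_form_inner[OF subspace_span[of B]] _ \<open>finite B\<close>]
    by (auto simp: span_superset \<open>X = span B\<close>)
  have exp1: "a x y = (\<Sum>e\<in>E. (x \<bullet> e) * a e y)" if "x \<in> X" "y \<in> X" for x y
  proof -
    have "a x y = a (\<Sum>e\<in>E. (x \<bullet> e) *\<^sub>R e) y"
      using E(3) that by simp
    also have "\<dots> = (\<Sum>e\<in>E. (x \<bullet> e) * a e y)"
      using E(2) that by (subst sum_left) (auto simp: scale_left X_closed intro!: sum.cong)
    finally show ?thesis .
  qed
  have exp2: "a x y = (\<Sum>e\<in>E. \<Sum>f\<in>E. (x \<bullet> e) * (y \<bullet> f) * a e f)" if "x \<in> X" "y \<in> X" for x y
  proof -
    have "a e y = (\<Sum>f\<in>E. (y \<bullet> f) * a e f)" if "e \<in> E" for e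
      using exp1[of y e] that \<open>y \<in> X\<close> E(2) commute by (auto simp: subset_iff cong: sum.cong)
    then show ?thesis
      using exp1[OF that] by (simp add: sum_distrib_left mult.assoc)
  qed
  have X': "u' \<in> X" "v' \<in> X"
    using has_vector_derivative_in_span[OF \<open>finite B\<close> _ u' \<open>t \<ge> 0\<close>]
      has_vector_derivative_in_span[OF \<open>finite B\<close> _ v' \<open>t \<ge> 0\<close>] u v \<open>X = span B\<close> by auto
  have D: "((\<lambda>t. w t \<bullet> e) has_real_derivative (w' \<bullet> e)) (at t within {0..})"
    if "(w has_vector_derivative w') (at t within {0..})" for w w' and e :: 'b
    using bounded_linear.has_vector_derivative[OF bounded_linear_inner_left that]
    by (simp add: has_real_derivative_iff_has_vector_derivative)
  have "((\<lambda>t. \<Sum>e\<in>E. \<Sum>f\<in>E. (u t \<bullet> e) * (v t \<bullet> f) * a e f) has_real_derivative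
      (\<Sum>e\<in>E. \<Sum>f\<in>E. ((u' \<bullet> e) * (v t \<bullet> f) + (v' \<bullet> f) * (u t \<bullet> e)) * a e f)) (at t within {0..})"
    by (intro DERIV_sum DERIV_mult DERIV_cmult_right D u' v')
  also have "(\<Sum>e\<in>E. \<Sum>f\<in>E. ((u' \<bullet> e) * (v t \<bullet> f) + (v' \<bullet> f) * (u t \<bullet> e)) * a e f) =
      a u' (v t) + a (u t) v'"
    using u[OF \<open>t \<ge> 0\<close>] v[OF \<open>t \<ge> 0\<close>] X' by (simp add: exp2 algebra_simps sum.distrib)
  finally show ?thesis
    by (rule has_field_derivative_transform_within[OF _ zero_less_one])
      (use u v \<open>t \<ge> 0\<close> exp2 in auto)
qed

section \<open>The Lyapunov functional\<close>

text \<open>\<open>l\<close> plays the role of the smallest eigenvalue; \<open>rate\<close> is the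
  bound on \<delta> by the minimum, cleared of denominators.\<close>

locale damped_form = symmetric_form X a for X :: "'b::real_inner set" and a +
  fixes \<alpha> \<beta> l \<delta> :: real
  assumes coercive: "v \<in> X \<Longrightarrow> l * (v \<bullet> v) \<le> a v v"
    and params: "\<alpha> \<ge> 0" "\<beta> \<ge> 0" "l > 0"
    and rate: "0 < \<delta>" "2 * \<delta> \<le> \<alpha> + \<beta> * l" "\<delta> * (\<alpha> + \<beta> * l) \<le> l"
begin

definition damp :: "'b \<Rightarrow> 'b \<Rightarrow> real" where
  "damp v w = \<beta> * a v w + \<alpha> * (v \<bullet> w)"

text \<open>The form of \<open>A\<^sub>h\<close> - \<delta> \<Gamma>, which on a mode is \<lambda> -
  \<delta> \<gamma>.\<close>

definition rest :: "'b \<Rightarrow> 'b \<Rightarrow> real" where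
  "rest v w = a v w - \<delta> * damp v w"

lemma symmetric_form_damp: "symmetric_form X damp"
  by unfold_locales (simp_all add: subspace damp_def commute bilinear inner_commute inner_add_left algebra_simps)

sublocale damp: symmetric_form X damp
  by (rule symmetric_form_damp)

lemma symmetric_form_rest: "symmetric_form X rest"
  by unfold_locales (simp_all add: subspace rest_def commute damp.commute bilinear damp.bilinear algebra_simps)

sublocale rest: symmetric_form X rest
  by (rule symmetric_form_rest)

lemma form_nonneg: "v \<in> X \<Longrightarrow> 0 \<le> a v v"
  by (rule order_trans[OF _ coercive]) (use params in auto)

lemma damp_ge: "v \<in> X \<Longrightarrow> (\<alpha> + \<beta> * l) * (v \<bullet> v) \<le> damp v v"
  using mult_left_mono[OF coercive[of v] params(2)] by (simp add: damp_def algebra_simps)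

lemma damp_ge_rate: "v \<in> X \<Longrightarrow> 2 * \<delta> * (v \<bullet> v) \<le> damp v v"
  by (rule order_trans[OF mult_right_mono[OF rate(2)] damp_ge]) auto

lemma rate_beta_le_1: "\<delta> * \<beta> \<le> 1"
proof -
  have "0 \<le> \<delta> * \<alpha>" using rate(1) params(1) by simp
  then have "(\<delta> * \<beta>) * l \<le> 1 * l" using rate(3) by (simp add: algebra_simps)
  then show ?thesis using params(3) by (simp only: mult_le_cancel_right_pos)
qed

text \<open>In \<open>rest\<close> the form \<open>a\<close> has the coefficient 1 - \<delta>
  \<beta> \<ge> 0, so coercivity reduces the claim to l - \<delta> (\<alpha> + \<beta> l) \<ge>
  0.\<close>

lemma rest_nonneg:
  assumes "v \<in> X"
  shows "0 \<le> rest v v"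
proof -
  have "(1 - \<delta> * \<beta>) * (l * (v \<bullet> v)) \<le> (1 - \<delta> * \<beta>) * a v v"
    using coercive[OF assms] rate_beta_le_1 by (intro mult_left_mono) auto
  moreover have "0 \<le> (l - \<delta> * (\<alpha> + \<beta> * l)) * (v \<bullet> v)"
    using rate(3) by simp
  ultimately show ?thesis
    by (simp add: rest_def damp_def algebra_simps)
qed

lemma form_ge_damp: "v \<in> X \<Longrightarrow> \<delta> * damp v v \<le> a v v"
  using rest_nonneg by (simp add: rest_def)

text \<open>\<open>riesz\<close> is the weak form of \<Gamma> g = f. On a mode, g is f /
  \<gamma>.\<close>

context
  fixes f g
  assumes f: "f \<in> X" and g: "g \<in> X" and riesz: "\<And>w. w \<in> X \<Longrightarrow> damp g w = f \<bullet> w"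
begin

lemma riesz_inner_nonneg: "2 * \<delta> * (f \<bullet> g) \<le> f \<bullet> f"
proof -
  have *: "2 * \<delta> * (g \<bullet> g) \<le> f \<bullet> g"
    using damp_ge_rate[OF g] riesz[OF g] by simp
  have "0 \<le> (f - (2 * \<delta>) *\<^sub>R g) \<bullet> (f - (2 * \<delta>) *\<^sub>R g)"
    by simp
  then have "0 \<le> f \<bullet> f - 4 * \<delta> * (f \<bullet> g) + 4 * \<delta>\<^sup>2 * (g \<bullet> g)"
    by (simp add: inner_diff_left inner_diff_right inner_commute power2_eq_square algebra_simps)
  moreover have "4 * \<delta>\<^sup>2 * (g \<bullet> g) \<le> 2 * \<delta> * (f \<bullet> g)"
    using mult_left_mono[OF *, of "2 * \<delta>"] rate(1)
    by (simp add: power2_eq_square algebra_simps)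
  ultimately show ?thesis by linarith
qed

text \<open>On a mode this is (\<gamma> - \<delta>) (1 - 2 \<delta> / \<gamma>), split as \<gamma>
  (1 - 2 \<delta> / \<gamma>)^2 + \<delta> (1 - 2 \<delta> / \<gamma>); \<open>?q\<close> carries
  the factor 1 - 2 \<delta> / \<gamma>.\<close>

lemma damp_residual_nonneg:
  "0 \<le> damp f f - 3 * \<delta> * (f \<bullet> f) + 2 * \<delta>\<^sup>2 * (f \<bullet> g)"
proof -
  let ?q = "f - (2 * \<delta>) *\<^sub>R g"
  have q: "?q \<in> X" using f g by (simp add: X_closed)
  have "0 \<le> damp ?q ?q"
    using damp_ge_rate[OF q] rate(1) by (meson inner_ge_zero mult_nonneg_nonneg order_trans less_imp_le zero_le_numeral)
  moreover have "0 \<le> \<delta> * (f \<bullet> ?q)"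
    using riesz_inner_nonneg rate(1) by (simp add: inner_diff_right)
  moreover have "damp ?q ?q = damp f f - 4 * \<delta> * (f \<bullet> f) + 4 * \<delta>\<^sup>2 * (f \<bullet> g)"
    using f g damp.commute[of f g] riesz[OF f] riesz[OF g]
    by (simp add: damp.bilinear X_closed power2_eq_square algebra_simps)
  ultimately show ?thesis
    by (simp add: inner_diff_right power2_eq_square algebra_simps)
qed

text \<open>Both \<^term>\<open>rest\<close> and the operator of \<^term>\<open>damp\<close> minus \<^term>\<open>2 * \<delta>\<close> are nonnegative
  combinations of the identity and of the nonnegative operator of the form
  \<^term>\<open>\<lambda>v w. a v w - l * (v \<bullet> w)\<close>, hence so is their product.\<close>

lemma rest_riesz_nonneg: "0 \<le> rest g (f - (2 * \<delta>) *\<^sub>R g)"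
proof (cases "\<beta> = 0")
  case True
  \<comment> \<open>Without the \<open>a\<close> part \<Gamma> is \<alpha> times the identity;
    testing \<open>riesz\<close> with \<open>?s\<close> shows that \<open>?s\<close>
    vanishes.\<close>
  let ?s = "f - \<alpha> *\<^sub>R g"
  have s: "?s \<in> X" using f g by (simp add: X_closed)
  have "?s \<bullet> ?s = 0"
    using riesz[OF s, unfolded damp_def] True by (simp add: inner_diff_left)
  then have "f = \<alpha> *\<^sub>R g" by simp
  moreover have nn: "0 \<le> \<alpha> - 2 * \<delta>"
    using rate(2) True by simp
  ultimately have "f - (2 * \<delta>) *\<^sub>R g = (\<alpha> - 2 * \<delta>) *\<^sub>R g"
    by (metis scaleR_diff_left)
  then show ?thesis
    using rest.scale_right[OF g g, of "\<alpha> - 2 * \<delta>"] nn rest_nonneg[OF g] by simp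
next
  case False
  then have \<beta>: "\<beta> > 0" using params by simp
  \<comment> \<open>Here \<open>?s\<close> represents \<beta> (\<open>A\<^sub>h\<close> - l) g, so
    \<open>a g ?s\<close> becomes a square plus l times an inner product.\<close>
  let ?s = "f - (\<alpha> + \<beta> * l) *\<^sub>R g"
  have s: "?s \<in> X" using f g by (simp add: X_closed)
  have shift: "\<beta> * (a g w - l * (g \<bullet> w)) = ?s \<bullet> w" if "w \<in> X" for w
    using riesz[OF that] by (simp add: damp_def inner_diff_left algebra_simps)
  have "a g ?s = (?s \<bullet> ?s) / \<beta> + l * (g \<bullet> ?s)"
    using shift[OF s] \<beta> by (simp add: field_simps)
  then have "rest g ?s = (1 - \<delta> * \<beta>) / \<beta> * (?s \<bullet> ?s) + (l - \<delta> * (\<alpha> + \<beta> * l)) * (g \<bullet> ?s)"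
    using \<beta> by (simp add: rest_def damp_def field_simps)
  moreover have "0 \<le> g \<bullet> ?s"
    using shift[OF g] coercive[OF g] \<beta> by (metis diff_ge_0_iff_ge inner_commute mult_nonneg_nonneg params(2))
  ultimately have "0 \<le> rest g ?s"
    using rate_beta_le_1 rate(3) \<beta> by simp
  moreover have "rest g (f - (2 * \<delta>) *\<^sub>R g) = rest g ?s + (\<alpha> + \<beta> * l - 2 * \<delta>) * rest g g"
    using f g by (simp add: rest.bilinear X_closed algebra_simps)
  ultimately show ?thesis
    using rest_nonneg[OF g] rate(2) by simp
qed

text \<open>The expression is \<open>rest f ?q\<close>; substituting f = \<open>?q\<close> + 2
  \<delta> g leaves two terms of known sign.\<close>

lemma rest_residual_nonneg: "0 \<le> rest f f - 2 * \<delta> * rest f g"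
proof -
  let ?q = "f - (2 * \<delta>) *\<^sub>R g"
  have q: "?q \<in> X" using f g by (simp add: X_closed)
  have "rest f f - 2 * \<delta> * rest f g = rest ?q ?q + 2 * \<delta> * rest g ?q"
    using f g rest.commute[of f g] by (simp add: rest.bilinear X_closed algebra_simps)
  then show ?thesis
    using rest_nonneg[OF q] rest_riesz_nonneg rate(1) by simp
qed

text \<open>The operator version of \<open>4/27 - y * (1 - y)\<^sup>2 = (y - 1/3)\<^sup>2 * (4/3 - y)\<close>.\<close>

lemma corrector_bound:
  "\<delta>\<^sup>2 * ((f - \<delta> *\<^sub>R g) \<bullet> (f - \<delta> *\<^sub>R g)) \<le> 4 / 27 * a f f"
proof -
  \<comment> \<open>With y for \<delta> times the inverse of \<Gamma>, \<open>?p\<close> is (y -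
    1/3) f. The identity is multiplied by \<delta> \<Gamma>, and 4/3 - y \<ge> 0 becomes the
    comparison of \<delta> (p, p) with 4/3 \<open>damp\<close>.\<close>
  let ?p = "\<delta> *\<^sub>R g - (1 / 3) *\<^sub>R f"
  have p: "?p \<in> X" using f g by (simp add: X_closed)
  have "0 \<le> ?p \<bullet> ?p" by simp
  then have "\<delta> * (?p \<bullet> ?p) \<le> 4 / 3 * damp ?p ?p"
    using damp_ge_rate[OF p] mult_nonneg_nonneg[of \<delta> "?p \<bullet> ?p"] rate(1) by linarith
  then have "0 \<le> \<delta> * (4 / 3 * damp ?p ?p - \<delta> * (?p \<bullet> ?p))"
    using rate(1) by simp
  also have "\<dots> = 4 / 27 * (\<delta> * damp f f) - \<delta>\<^sup>2 * ((f - \<delta> *\<^sub>R g) \<bullet> (f - \<delta> *\<^sub>R g))"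
    using f g damp.commute[of f g] riesz[OF f] riesz[OF g]
    by (simp add: damp.bilinear X_closed inner_diff_left inner_diff_right inner_commute
        power2_eq_square field_simps)
  finally show ?thesis
    using form_ge_damp[OF f] by linarith
qed

lemma cross_term_bound:
  "\<bar>4 * \<delta> * (p \<bullet> (f - \<delta> *\<^sub>R g))\<bar> \<le> 4 / 5 * (p \<bullet> p + a f f)"
proof -
  let ?k = "f - \<delta> *\<^sub>R g"
  \<comment> \<open>The weights 2 and 5 work because 25 * 4/27 \<le> 4: both terms get the constant
    4, and division by 5 gives 4/5 < 1, which keeps \<open>lyapunov\<close> positive.\<close>
  have "0 \<le> (2 *\<^sub>R p - (5 * \<delta>) *\<^sub>R ?k) \<bullet> (2 *\<^sub>R p - (5 * \<delta>) *\<^sub>R ?k)"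
    "0 \<le> (2 *\<^sub>R p + (5 * \<delta>) *\<^sub>R ?k) \<bullet> (2 *\<^sub>R p + (5 * \<delta>) *\<^sub>R ?k)"
    by simp_all
  then have "20 * \<bar>\<delta> * (p \<bullet> ?k)\<bar> \<le> 4 * (p \<bullet> p) + 25 * (\<delta>\<^sup>2 * (?k \<bullet> ?k))"
    unfolding inner_add_left inner_add_right inner_diff_left[of "2 *\<^sub>R p"] inner_diff_right[of _ "2 *\<^sub>R p"]
      inner_scaleR_left inner_scaleR_right inner_commute[of ?k p]
    by (auto simp: power2_eq_square abs_if algebra_simps simp del: inner_diff_left inner_diff_right)
  moreover have "25 * (\<delta>\<^sup>2 * (?k \<bullet> ?k)) \<le> 4 * a f f"
    using corrector_bound form_nonneg[OF f] by linarith
  ultimately have "\<bar>4\<bar> * \<bar>\<delta> * (p \<bullet> ?k)\<bar> \<le> 4 / 5 * (p \<bullet> p + a f f)"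
    by simp
  then show ?thesis
    by (simp only: abs_mult mult.assoc)
qed

end

definition lyapunov :: "'b \<Rightarrow> 'b \<Rightarrow> 'b \<Rightarrow> real" where
  "lyapunov u u' g = u' \<bullet> u' + a u u + 4 * \<delta> * (u' \<bullet> (u - \<delta> *\<^sub>R g))"

text \<open>The left side is -2 times the sum of three nonnegative terms: one in u' + \<delta> u,
  and two in u that split the modal factor \<lambda> - \<delta> \<gamma> + \<delta>^2 into
  \<open>rest\<close> and \<delta>^2.\<close>

lemma lyapunov_decay:
  assumes X: "u \<in> X" "u' \<in> X" "g \<in> X" "g' \<in> X"
    and g: "\<And>w. w \<in> X \<Longrightarrow> damp g w = u \<bullet> w" and g': "\<And>w. w \<in> X \<Longrightarrow> damp g' w = u' \<bullet> w"
    and eq: "\<And>w. w \<in> X \<Longrightarrow> u'' \<bullet> w + damp u' w + a u w = 0"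
  shows "2 * (u'' \<bullet> u') + 2 * a u u' + 4 * \<delta> * (u'' \<bullet> (u - \<delta> *\<^sub>R g) + u' \<bullet> (u' - \<delta> *\<^sub>R g'))
     + 2 * \<delta> * lyapunov u u' g \<le> 0"
proof -
  let ?y = "u' + \<delta> *\<^sub>R u" and ?h = "g' + \<delta> *\<^sub>R g"
  have y: "?y \<in> X" and h: "?h \<in> X" using X by (simp_all add: X_closed)
  have rep: "damp ?h w = ?y \<bullet> w" if "w \<in> X" for w
    using that X g g' by (simp add: damp.bilinear X_closed inner_add_left)
  \<comment> \<open>Symmetry of the inverse of \<Gamma>.\<close>
  have sym: "u \<bullet> g' = u' \<bullet> g"
    using g[OF X(4)] g'[OF X(3)] damp.commute[OF X(3,4)] by simp
  have "0 \<le> damp ?y ?y - 3 * \<delta> * (?y \<bullet> ?y) + 2 * \<delta>\<^sup>2 * (?y \<bullet> ?h)"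
    by (rule damp_residual_nonneg[OF y h rep])
  moreover have "0 \<le> \<delta> * (rest u u - 2 * \<delta> * rest u g)"
    using rest_residual_nonneg[OF X(1,3) g] rate(1) by simp
  moreover have "0 \<le> \<delta> ^ 3 * (u \<bullet> u - 2 * \<delta> * (u \<bullet> g))"
    using riesz_inner_nonneg[OF X(1,3) g] rate(1) by simp
  moreover have "2 * (u'' \<bullet> u') + 2 * a u u' + 4 * \<delta> * (u'' \<bullet> (u - \<delta> *\<^sub>R g) + u' \<bullet> (u' - \<delta> *\<^sub>R g'))
      + 2 * \<delta> * lyapunov u u' g =
    - 2 * ((damp ?y ?y - 3 * \<delta> * (?y \<bullet> ?y) + 2 * \<delta>\<^sup>2 * (?y \<bullet> ?h))
      + \<delta> * (rest u u - 2 * \<delta> * rest u g) + \<delta> ^ 3 * (u \<bullet> u - 2 * \<delta> * (u \<bullet> g)))"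
  proof -
    \<comment> \<open>Testing the equation with u', u and g eliminates the acceleration.\<close>
    have e1: "u'' \<bullet> u' = - damp u' u' - a u u'"
      using eq[OF X(2)] by simp
    have e2: "u'' \<bullet> u = - damp u' u - a u u"
      using eq[OF X(1)] by simp
    have e3: "u'' \<bullet> g = - damp u' g - a u g"
      using eq[OF X(3)] by simp
    have e4: "damp u' g = u' \<bullet> u" "damp u g = u \<bullet> u" "damp u u' = damp u' u" "u \<bullet> u' = u' \<bullet> u"
      using g[OF X(1)] g[OF X(2)] damp.commute X by (simp_all add: inner_commute)
    show ?thesis
      using X by (simp add: lyapunov_def rest_def inner_add_left inner_add_right inner_diff_right
          damp.bilinear X_closed e1 e2 e3 e4 sym power2_eq_square power3_eq_cube algebra_simps)
  qed
  moreover have "x \<le> 0" if "0 \<le> A" "0 \<le> B" "0 \<le> C" "x = - 2 * (A + B + C)" for x A B C :: real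
    using that by simp
  ultimately show ?thesis by blast
qed

lemma lyapunov_bounds:
  assumes "u \<in> X" "g \<in> X" "\<And>w. w \<in> X \<Longrightarrow> damp g w = u \<bullet> w"
  shows "1 / 5 * (u' \<bullet> u' + a u u) \<le> lyapunov u u' g"
    and "lyapunov u u' g \<le> 9 / 5 * (u' \<bullet> u' + a u u)"
  using cross_term_bound[OF assms, of u'] unfolding lyapunov_def by (simp_all add: abs_le_iff)

end

section \<open>From the differential inequality to exponential decay\<close>

lemma antimono_from_within_derivative:
  fixes f :: "real \<Rightarrow> real"
  assumes "\<And>t. 0 \<le> t \<Longrightarrow> (f has_real_derivative f' t) (at t within {0..})"
    and "\<And>t. 0 \<le> t \<Longrightarrow> f' t \<le> 0" and "0 \<le> T"
  shows "f T \<le> f 0"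
proof -
  have "(f has_derivative (\<lambda>h. f' t * h)) (at t within {0..T})" if "0 \<le> t" "t \<le> T" for t
    using assms(1)[OF that(1)] unfolding has_field_derivative_def
    by (rule has_derivative_subset) auto
  then obtain s where "s \<in> {0..T}" "f T - f 0 = f' s * (T - 0)"
    using mvt_very_simple[OF \<open>0 \<le> T\<close>, of f "\<lambda>t h. f' t * h"] by auto
  moreover from this have "f' s * T \<le> 0"
    using assms(2)[of s] \<open>0 \<le> T\<close> by (intro mult_nonpos_nonneg) auto
  ultimately show ?thesis by simp
qed

lemma has_real_derivative_inner:
  fixes v w :: "real \<Rightarrow> 'b::real_inner"
  assumes "(v has_vector_derivative v') (at t within S)" "(w has_vector_derivative w') (at t within S)"
  shows "((\<lambda>t. v t \<bullet> w t) has_real_derivative v' \<bullet> w t + v t \<bullet> w') (at t within S)"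
  using bounded_bilinear.has_vector_derivative[OF bounded_bilinear_inner assms]
  by (simp add: has_real_derivative_iff_has_vector_derivative add.commute)

context damped_form
begin

text \<open>The inverse of \<Gamma>, written explicitly in a \<open>damp\<close>-orthonormal basis.
  Bounded linearity lets it be differentiated along the solution.\<close>

lemma riesz_map_exists:
  assumes "finite B" "X = span B"
  obtains G where "bounded_linear G" "\<And>f. G f \<in> X" "\<And>f w. w \<in> X \<Longrightarrow> damp (G f) w = f \<bullet> w"
proof -
  have pos: "0 < damp v v" if "v \<in> X" "v \<noteq> 0" for v
  proof -
    have "0 < 2 * \<delta> * (v \<bullet> v)" using that rate(1) by simp
    then show ?thesis using damp_ge_rate[OF that(1)] by linarith
  qed
  have "B \<subseteq> X" using assms(2) by (simp add: span_superset)
  from damp.orthonormal_basis_exists[OF pos \<open>finite B\<close> this]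
  obtain E where E: "finite E" "E \<subseteq> X" and exp: "\<And>w. w \<in> X \<Longrightarrow> (\<Sum>e\<in>E. damp w e *\<^sub>R e) = w"
    unfolding \<open>X = span B\<close>[symmetric] by blast
  define G where "G f = (\<Sum>e\<in>E. (f \<bullet> e) *\<^sub>R e)" for f
  show ?thesis
  proof (rule that[of G])
    show "bounded_linear G"
      unfolding G_def
      by (intro bounded_linear_sum bounded_linear_compose[OF bounded_linear_scaleR_left bounded_linear_inner_left])
    show "G f \<in> X" for f
      unfolding G_def using E(2) by (intro subspace_sum[OF subspace] X_closed) auto
    show "damp (G f) w = f \<bullet> w" if "w \<in> X" for f w
    proof -
      have "damp (G f) w = (\<Sum>e\<in>E. damp ((f \<bullet> e) *\<^sub>R e) w)"
        unfolding G_def using E(2) that by (intro damp.sum_left) (auto intro: X_closed)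
      also have "\<dots> = (\<Sum>e\<in>E. damp w e * (f \<bullet> e))"
        using E(2) that by (intro sum.cong) (auto simp: damp.scale_left damp.commute subset_iff)
      also have "\<dots> = f \<bullet> (\<Sum>e\<in>E. damp w e *\<^sub>R e)"
        by (simp add: inner_sum_right)
      finally show ?thesis using exp[OF that] by simp
    qed
  qed
qed

text \<open>By \<open>lyapunov_decay\<close> the product of exp (2 \<delta> t) and the functional is
  nonincreasing; the two-sided bounds then return to the energy.\<close>

theorem energy_decay:
  assumes fin: "finite B" "X = span B"
    and u: "\<And>t. 0 \<le> t \<Longrightarrow> u t \<in> X"
    and u': "\<And>t. 0 \<le> t \<Longrightarrow> (u has_vector_derivative u' t) (at t within {0..})"
    and u'': "\<And>t. 0 \<le> t \<Longrightarrow> (u' has_vector_derivative u'' t) (at t within {0..})"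
    and eq: "\<And>t w. 0 \<le> t \<Longrightarrow> w \<in> X \<Longrightarrow> u'' t \<bullet> w + damp (u' t) w + a (u t) w = 0"
    and "0 \<le> t"
  shows "u' t \<bullet> u' t + a (u t) (u t) \<le> 9 * exp (- 2 * \<delta> * t) * (u' 0 \<bullet> u' 0 + a (u 0) (u 0))"
proof -
  obtain G where G: "bounded_linear G" "\<And>f. G f \<in> X" "\<And>f w. w \<in> X \<Longrightarrow> damp (G f) w = f \<bullet> w"
    using riesz_map_exists[OF fin] by blast
  have u'_in: "u' t \<in> X" if "0 \<le> t" for t
    using has_vector_derivative_in_span[OF fin(1) _ u'[OF that] that] u fin(2) by blast
  let ?V = "\<lambda>t. lyapunov (u t) (u' t) (G (u t))"
  define V' where "V' t = 2 * (u'' t \<bullet> u' t) + 2 * a (u t) (u' t) +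
      4 * \<delta> * (u'' t \<bullet> (u t - \<delta> *\<^sub>R G (u t)) + u' t \<bullet> (u' t - \<delta> *\<^sub>R G (u' t)))" for t
  have V: "(?V has_real_derivative V' t) (at t within {0..})" if t: "0 \<le> t" for t
  proof -
    have "((\<lambda>t. u t - \<delta> *\<^sub>R G (u t)) has_vector_derivative u' t - \<delta> *\<^sub>R G (u' t)) (at t within {0..})"
      by (intro has_vector_derivative_diff u'[OF t]
          bounded_linear.has_vector_derivative[OF bounded_linear_compose[OF bounded_linear_scaleR_right G(1)]])
    note DERIV_add[OF DERIV_add[OF has_real_derivative_inner[OF u''[OF t] u''[OF t]]
        has_real_derivative_form[OF fin u u u'[OF t] u'[OF t] t]]
      DERIV_cmult[OF has_real_derivative_inner[OF u''[OF t] this], of "4 * \<delta>"]]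
    moreover have "u'' t \<bullet> u' t + u' t \<bullet> u'' t + (a (u' t) (u t) + a (u t) (u' t)) +
        4 * \<delta> * (u'' t \<bullet> (u t - \<delta> *\<^sub>R G (u t)) + u' t \<bullet> (u' t - \<delta> *\<^sub>R G (u' t))) = V' t"
      unfolding V'_def inner_commute[of "u' t" "u'' t"] commute[OF u'_in[OF t] u[OF t]] by simp
    ultimately show ?thesis
      unfolding lyapunov_def by simp
  qed
  have W: "((\<lambda>t. exp (2 * \<delta> * t) * ?V t) has_real_derivative
      exp (2 * \<delta> * t) * (V' t + 2 * \<delta> * ?V t)) (at t within {0..})" if "0 \<le> t" for t
    by (rule derivative_eq_intros V[OF that] refl)+ (simp add: algebra_simps)
  have "V' t + 2 * \<delta> * ?V t \<le> 0" if "0 \<le> t" for t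
    unfolding V'_def by (rule lyapunov_decay) (use that u u'_in G(2,3) eq in auto)
  then have "exp (2 * \<delta> * t) * ?V t \<le> exp (2 * \<delta> * 0) * ?V 0"
    by (intro antimono_from_within_derivative[OF W _ \<open>0 \<le> t\<close>]) (auto intro: mult_nonneg_nonpos)
  then have "?V t \<le> exp (- 2 * \<delta> * t) * ?V 0"
    by (simp add: exp_minus field_simps)
  also have "\<dots> \<le> exp (- 2 * \<delta> * t) * (9 / 5 * (u' 0 \<bullet> u' 0 + a (u 0) (u 0)))"
    by (intro mult_left_mono lyapunov_bounds(2) u G(2,3)) auto
  \<comment> \<open>The constant 9 is the quotient of the bounds 9/5 and 1/5.\<close>
  finally show ?thesis
    using lyapunov_bounds(1)[OF u[OF \<open>0 \<le> t\<close>] G(2,3), of "u' t"] by (simp add: algebra_simps)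
qed

end

section \<open>The semidiscrete problem\<close>

lemma semidiscrete_energy_decay:
  assumes "open \<Omega>" "poincare_inequality \<Omega> l" "Xh \<subseteq> H01 \<Omega>" "finite B" "Xh = span B"
    and params: "\<alpha> \<ge> 0" "\<beta> \<ge> 0" "l > 0" "\<alpha> + \<beta> * l > 0"
    and \<delta>: "0 < \<delta>" "\<delta> \<le> min ((\<alpha> + \<beta> * l) / 2) (l / (\<alpha> + \<beta> * l))"
    and sol: "semidiscrete_solution \<Omega> \<alpha> \<beta> Xh u0 u1 u u' u''"
    and "0 \<le> t"
  shows "energy \<Omega> u u' t \<le> 9 * exp (- 2 * \<delta> * t) * energy \<Omega> u u' 0"
proof -
  have H1: "v \<in> H1 \<Omega>" if "v \<in> Xh" for v
    using that assms(3) by (auto simp: H01_def)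
  interpret damped_form Xh "grad_form \<Omega>" \<alpha> \<beta> l \<delta>
  proof
    show "subspace Xh"
      using assms(5) by simp
    show "l * (v \<bullet> v) \<le> grad_form \<Omega> v v" if "v \<in> Xh" for v
    proof -
      have "(norm v)\<^sup>2 \<le> inverse l * grad_form \<Omega> v v"
        using assms(2,3) that by (auto simp: poincare_inequality_def H1_seminorm_sq)
      then show ?thesis
        using params(3) by (simp add: dot_square_norm field_simps)
    qed
    show "2 * \<delta> \<le> \<alpha> + \<beta> * l" "\<delta> * (\<alpha> + \<beta> * l) \<le> l"
      using \<delta>(2) params(4) by (simp_all add: pos_le_divide_eq)
  qed (use assms(1) H1 params \<delta>(1) in
      \<open>auto simp: grad_form_add_left grad_form_scaleR_left intro: grad_form_commute\<close>)
  have "u' t \<bullet> u' t + grad_form \<Omega> (u t) (u t) \<le>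
      9 * exp (- 2 * \<delta> * t) * (u' 0 \<bullet> u' 0 + grad_form \<Omega> (u 0) (u 0))"
    by (rule energy_decay[OF assms(4,5) _ _ _ _ \<open>0 \<le> t\<close>, where u'' = u''])
      (use sol in \<open>auto simp: semidiscrete_solution_def damp_def add.assoc\<close>)
  then show ?thesis
    by (simp add: energy_def H1_seminorm_sq dot_square_norm)
qed

theorem theorem3p1:
  fixes \<alpha> \<beta> lam1 :: real
  assumes "(\<alpha> > 0 \<and> \<beta> \<ge> 0) \<or> (\<alpha> \<ge> 0 \<and> \<beta> > 0)"
    and "lam1 > 0"
  shows
    "(\<exists>C>0. \<forall>(\<Omega> :: 'a::euclidean_space set) H \<T> X.
        bounded_domain \<Omega> \<and> smallest_dirichlet_eigenvalue \<Omega> lam1 \<and> poincare_inequality \<Omega> lam1 \<and>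
        fe_family \<Omega> H \<T> X \<longrightarrow>
        (\<forall>\<delta>. 0 < \<delta> \<and> \<delta> \<le> min ((\<alpha> + \<beta> * lam1) / 2) (lam1 / (\<alpha> + \<beta> * lam1)) \<and>
           (\<delta> < min ((\<alpha> + \<beta> * lam1) / 2) (lam1 / (\<alpha> + \<beta> * lam1)) \<or> \<delta> = (\<alpha> + \<beta> * lam1) / 2) \<longrightarrow>
           (\<forall>h\<in>H. \<forall>u0 u1 u u' u''. semidiscrete_solution \<Omega> \<alpha> \<beta> (X h) u0 u1 u u' u'' \<longrightarrow>
              (\<forall>t\<ge>0. energy \<Omega> u u' t \<le> C * exp (- 2 * \<delta> * t) * energy \<Omega> u u' 0))))
     \<and>
     (\<forall>(\<Omega> :: 'a set) H \<T> X.
        bounded_domain \<Omega> \<and> smallest_dirichlet_eigenvalue \<Omega> lam1 \<and> poincare_inequality \<Omega> lam1 \<and>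
        fe_family \<Omega> H \<T> X \<longrightarrow>
        (\<forall>\<delta>. 0 < \<delta> \<and> \<delta> \<le> min ((\<alpha> + \<beta> * lam1) / 2) (lam1 / (\<alpha> + \<beta> * lam1)) \<and>
           \<delta> = lam1 / (\<alpha> + \<beta> * lam1) \<longrightarrow>
           (\<exists>C>0. \<forall>h\<in>H. \<forall>u0 u1 u u' u''. semidiscrete_solution \<Omega> \<alpha> \<beta> (X h) u0 u1 u u' u'' \<longrightarrow>
              (\<forall>t\<ge>0. (norm (u' t))\<^sup>2 \<le> C * exp (- 2 * \<delta> * t) * energy \<Omega> u u' 0))))"
proof -
  have pos: "\<alpha> \<ge> 0" "\<beta> \<ge> 0" "\<alpha> + \<beta> * lam1 > 0"
    using assms by (auto intro: add_pos_nonneg add_nonneg_pos)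
  \<comment> \<open>This covers the closed range of \<delta> up to the minimum and so serves both
    statements.\<close>
  have decay: "energy \<Omega> u u' t \<le> 9 * exp (- 2 * \<delta> * t) * energy \<Omega> u u' 0"
    if dom: "bounded_domain \<Omega>" "poincare_inequality \<Omega> lam1" and fe: "fe_family \<Omega> H \<T> X" "h \<in> H" and
      sol: "0 < \<delta>" "\<delta> \<le> min ((\<alpha> + \<beta> * lam1) / 2) (lam1 / (\<alpha> + \<beta> * lam1))"
      "semidiscrete_solution \<Omega> \<alpha> \<beta> (X h) u0 u1 u u' u''" "0 \<le> t"
    for \<Omega> :: "'a set" and H \<T> X \<delta> h u0 u1 u u' u'' t
  proof -
    obtain B where B: "X h \<subseteq> H01 \<Omega>" "finite B" "X h = span B"
      using fe unfolding fe_family_def by blast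
    have "open \<Omega>"
      using dom(1) by (simp add: bounded_domain_def)
    then show ?thesis
      by (rule semidiscrete_energy_decay[OF _ dom(2) B pos(1,2) assms(2) pos(3) sol])
  qed
  show ?thesis
  proof (rule conjI, goal_cases)
    case 1
    show ?case
      by (intro exI[of _ "9::real"] conjI allI impI ballI decay) auto
  next
    case 2
    show ?case
    proof (intro allI impI)
      fix \<Omega> :: "'a set" and H \<T> X \<delta>
      assume *: "bounded_domain \<Omega> \<and> smallest_dirichlet_eigenvalue \<Omega> lam1 \<and> poincare_inequality \<Omega> lam1 \<and>
          fe_family \<Omega> H \<T> X"
        and \<delta>: "0 < \<delta> \<and> \<delta> \<le> min ((\<alpha> + \<beta> * lam1) / 2) (lam1 / (\<alpha> + \<beta> * lam1)) \<and>
          \<delta> = lam1 / (\<alpha> + \<beta> * lam1)"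
      have "(norm (u' t))\<^sup>2 \<le> 18 * exp (- 2 * \<delta> * t) * energy \<Omega> u u' 0"
        if "h \<in> H" "semidiscrete_solution \<Omega> \<alpha> \<beta> (X h) u0 u1 u u' u''" "0 \<le> t"
        for h u0 u1 u u' u'' t
      proof -
        \<comment> \<open>The kinetic part is at most twice the energy, whence 18 = 2 * 9.\<close>
        have "(norm (u' t))\<^sup>2 \<le> 2 * energy \<Omega> u u' t"
          by (simp add: energy_def)
        moreover have "energy \<Omega> u u' t \<le> 9 * exp (- 2 * \<delta> * t) * energy \<Omega> u u' 0"
          using * \<delta> that by (intro decay) auto
        ultimately show ?thesis by linarith
      qed
      then show "\<exists>C>0. \<forall>h\<in>H. \<forall>u0 u1 u u' u''. semidiscrete_solution \<Omega> \<alpha> \<beta> (X h) u0 u1 u u' u'' \<longrightarrow>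
          (\<forall>t\<ge>0. (norm (u' t))\<^sup>2 \<le> C * exp (- 2 * \<delta> * t) * energy \<Omega> u u' 0)"
        by (intro exI[of _ "18::real"]) simp
    qed
  qed
qed

end
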